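(* Let $p$ be a prime, $n\geq 1$, $\beta>0$, and let $f(\xi)\in\mathbb{Z}_p[\xi_1,\ldots,\xi_n]$ be an elliptic polynomial of degree $d$. Let $Z_t$, $t>0$, be the heat kernel attached to $|f|_p^{\beta}$, regarded also as the measure $Z_t(E)=\int_E Z_t(x)\,d^nx$, and let $Z$ be the Lévy measure for the convolution semigroup $(Z_t)_{t>0}$ on $\mathbb{Q}_p^n$. Then the following conditions are equivalent: (i) for all open neighbourhoods $W$ of $0$ in $\mathbb{Q}_p^n$, $\displaystyle\lim_{t\to0^+}\frac1t\,Z_t(\mathbb{Q}_p^n\setminus W)=0$; (ii) $Z=0$; (iii) $|f(\xi)|_p^{\beta}=c+il(\xi)+q(\xi)$ for all $\xi\in\mathbb{Q}_p^n$, where $c\geq0$, $l:\mathbb{Q}_p^n\to\mathbb{R}$ is a continuous homomorphism and $q:\mathbb{Q}_p^n\to\mathbb{R}$ is a non-negative, continuous quadratic form.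
   Context: $\mathbb{Q}_p^n$ carries the norm $\|x\|_p=\max_i|x_i|_p$ and the Haar measure $d^nx$ normalized by $\int_{\mathbb{Z}_p^n}d^nx=1$. $\chi_p(y)=\exp(2\pi i\{y\}_p)$ is the standard additive character of $\mathbb{Q}_p$, and $x\cdot\xi=\sum_j x_j\xi_j$. A non-constant polynomial $f(\xi)\in\mathbb{Q}_p[\xi_1,\ldots,\xi_n]$ is an elliptic polynomial of degree $d$ if it is homogeneous of degree $d$ and, for $\xi\in\mathbb{Q}_p^n$, $f(\xi)=0\Leftrightarrow\xi=0$. The heat kernel is $Z_t(x)=\int_{\mathbb{Q}_p^n}\chi_p(-x\cdot\xi)\,e^{-t|f(\xi)|_p^{\beta}}\,d^n\xi$, $t>0$, $x\in\mathbb{Q}_p^n$; $Z_t\in L^1(\mathbb{Q}_p^n)$. A convolution semigroup on $\mathbb{Q}_p^n$ is a family $(\mu_t)_{t>0}$ of positive bounded measures with $\mu_t(\mathbb{Q}_p^n)\leq1$, $\mu_t\ast\mu_s=\mu_{t+s}$ for $t,s>0$, and $\lim_{t\to0^+}\mu_t=\delta_0$ vaguely. The measures $Z_t(x)\,d^nx$, $t>0$, form a convolution semigroup on $\mathbb{Q}_p^n$. Its Lévy measure $Z$ is the positive measure on $\mathbb{Q}_p^n\setminus\{0\}$ that is the vague limit, as $t\to0^+$, of $\frac1tZ_t|_{\mathbb{Q}_p^n\setminus\{0\}}$ (this limit exists). A function $q:\mathbb{Q}_p^n\to\mathbb{R}$ is a quadratic form if $2q(x)+2q(\xi)=q(x+\xi)+q(x-\xi)$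 for all $x,\xi\in\mathbb{Q}_p^n$. A homomorphism $l:\mathbb{Q}_p^n\to\mathbb{R}$ is a homomorphism of additive groups. *)

theory Defs
  imports
    "HOL-Analysis.Analysis"
    "HOL-Computational_Algebra.Primes"
    "HOL-Library.Poly_Mapping"
begin

text \<open>
  The prime is carried by a type: \<open>'p padic\<close> is the completion of the rationals with respect to
  the p-adic absolute value for \<open>p = CARD('p)\<close>, constructed as Cauchy sequences modulo null
  sequences.
\<close>

class prime_card = finite +
  assumes prime_card: "prime CARD('a)"

definition rat_norm :: "nat \<Rightarrow> rat \<Rightarrow> real" where
  "rat_norm p x = (if x = 0 then 0
     else real p powi (int (multiplicity (int p) (snd (quotient_of x)))
                       - int (multiplicity (int p) (fst (quotient_of x)))))"

lemma rat_norm_0 [simp]: "rat_norm p 0 = 0"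
  by (simp add: rat_norm_def)

lemma rat_norm_of_int_div:
  assumes p: "prime p" and a: "a \<noteq> 0" and b: "b \<noteq> 0"
  shows "rat_norm p (of_int a / of_int b)
    = real p powi (int (multiplicity (int p) b) - int (multiplicity (int p) a))"
proof -
  define x :: rat where "x = of_int a / of_int b"
  obtain c d where cd: "quotient_of x = (c, d)" by fastforce
  have d: "d > 0" using quotient_of_denom_pos[OF cd] .
  have x: "x = of_int c / of_int d" using quotient_of_div[OF cd] .
  have x0: "x \<noteq> 0" using a b by (simp add: x_def)
  then have c: "c \<noteq> 0" using x by auto
  have "(of_int (a * d) :: rat) = of_int (c * b)"
    using x d b unfolding x_def by (simp add: field_simps)
  then have eq: "a * d = c * b" by (simp only: of_int_eq_iff)
  have pe: "prime_elem (int p)" using p by simp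
  have "multiplicity (int p) a + multiplicity (int p) d = multiplicity (int p) c + multiplicity (int p) b"
    using arg_cong[OF eq, of "multiplicity (int p)"] a b c d pe
    by (simp add: prime_elem_multiplicity_mult_distrib)
  then have "int (multiplicity (int p) d) - int (multiplicity (int p) c)
      = int (multiplicity (int p) b) - int (multiplicity (int p) a)" by linarith
  then show ?thesis using x0 cd by (simp add: rat_norm_def flip: x_def)
qed

lemma rat_as_div: "\<exists>a b. b \<noteq> 0 \<and> (x::rat) = of_int a / of_int b"
proof -
  obtain a b where ab: "quotient_of x = (a, b)" by fastforce
  then show ?thesis
    using quotient_of_div[OF ab] quotient_of_denom_pos[OF ab] by (intro exI[of _ a] exI[of _ b]) simp
qed

lemma rat_norm_nonneg: "0 \<le> rat_norm p x"
  by (simp add: rat_norm_def)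

lemma rat_norm_eq_0_iff: "prime p \<Longrightarrow> rat_norm p x = 0 \<longleftrightarrow> x = 0"
  by (auto simp: rat_norm_def power_int_0_left_if dest: prime_gt_0_nat)

lemma rat_norm_mult:
  assumes p: "prime p"
  shows "rat_norm p (x * y) = rat_norm p x * rat_norm p y"
proof (cases "x = 0 \<or> y = 0")
  case False
  obtain a b c d where x: "b \<noteq> 0" "x = of_int a / of_int b" and y: "d \<noteq> 0" "y = of_int c / of_int d"
    using rat_as_div by metis
  have ac: "a \<noteq> 0" "c \<noteq> 0" using False x y by auto
  have xy: "x * y = of_int (a * c) / of_int (b * d)" using x y by simp
  have pe: "prime_elem (int p)" using p by simp
  have p0: "real p \<noteq> 0" using prime_gt_0_nat[OF p] by simp
  show ?thesis
    unfolding xy using x y ac pe p0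
    by (subst rat_norm_of_int_div[OF p])
       (simp_all add: rat_norm_of_int_div[OF p] prime_elem_multiplicity_mult_distrib
          power_int_add[symmetric] algebra_simps)
qed auto

lemma rat_norm_1: "prime p \<Longrightarrow> rat_norm p 1 = 1"
  using rat_norm_of_int_div[of p 1 1] by simp

lemma rat_norm_minus: "rat_norm p (- x) = rat_norm p x"
proof -
  have "multiplicity (int p) (- a) = multiplicity (int p) a" for a
    using multiplicity_times_unit_right[of "- 1 :: int" "int p" a] by simp
  then show ?thesis
    by (cases "quotient_of x") (auto simp: rat_norm_def rat_uminus_code)
qed

lemma rat_norm_minus_commute: "rat_norm p (x - y) = rat_norm p (y - x)"
  using rat_norm_minus[of p "x - y"] by simp

lemma rat_norm_inverse:
  assumes p: "prime p"
  shows "rat_norm p (inverse x) = inverse (rat_norm p x)"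
proof (cases "x = 0")
  case False
  have "rat_norm p x * rat_norm p (inverse x) = 1"
    using False p by (simp flip: rat_norm_mult add: rat_norm_1)
  then show ?thesis by (metis inverse_unique)
qed auto

lemma rat_norm_add:
  assumes p: "prime p"
  shows "rat_norm p (x + y) \<le> max (rat_norm p x) (rat_norm p y)"
proof (cases "x = 0 \<or> y = 0 \<or> x + y = 0")
  case True
  then show ?thesis using rat_norm_nonneg[of p] by (auto simp: le_max_iff_disj)
next
  case False
  obtain a b c d where x: "b \<noteq> 0" "x = of_int a / of_int b" and y: "d \<noteq> 0" "y = of_int c / of_int d"
    using rat_as_div by metis
  define A B E where "A = a * d" and "B = c * b" and "E = b * d"
  have E: "E \<noteq> 0" and xA: "x = of_int A / of_int E" and yB: "y = of_int B / of_int E"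
    and xy: "x + y = of_int (A + B) / of_int E"
    using x y by (simp_all add: A_def B_def E_def add_frac_eq field_simps)
  have A: "A \<noteq> 0" and B: "B \<noteq> 0" and AB: "A + B \<noteq> 0"
    using False xA yB xy by (auto simp del: of_int_add)
  let ?m = "multiplicity (int p)"
  have np: "\<not> is_unit (int p)" using p by (metis int_dvd_int_iff nat_int_comparison(1) not_prime_unit of_nat_1)
  have "int p ^ min (?m A) (?m B) dvd A + B"
    by (intro dvd_add multiplicity_dvd') auto
  then have le: "min (?m A) (?m B) \<le> ?m (A + B)"
    using AB np by (intro multiplicity_geI) auto
  have p1: "1 \<le> real p" using prime_ge_1_nat[OF p] by simp
  have "real p powi (int (?m E) - int (?m (A + B)))
      \<le> real p powi (int (?m E) - int (min (?m A) (?m B)))"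
    using le p1 by (intro power_int_increasing) auto
  also have "\<dots> \<le> max (rat_norm p x) (rat_norm p y)"
    by (simp add: xA yB rat_norm_of_int_div[OF p] A B E min_def)
  finally show ?thesis
    unfolding xy by (subst rat_norm_of_int_div[OF p AB E])
qed

lemma rat_norm_add_le: "prime p \<Longrightarrow> rat_norm p (x + y) \<le> rat_norm p x + rat_norm p y"
  using rat_norm_add[of p x y] rat_norm_nonneg[of p x] rat_norm_nonneg[of p y] by linarith

lemma rat_norm_diff_abs:
  assumes "prime p" shows "\<bar>rat_norm p x - rat_norm p y\<bar> \<le> rat_norm p (x - y)"
  using rat_norm_add_le[OF assms, of "x - y" y] rat_norm_add_le[OF assms, of "y - x" x]
    rat_norm_minus_commute[of p x y] by simp

definition padic_cauchy :: "nat \<Rightarrow> (nat \<Rightarrow> rat) \<Rightarrow> bool" where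
  "padic_cauchy p X \<longleftrightarrow> (\<forall>e>0. \<exists>N. \<forall>m\<ge>N. \<forall>n\<ge>N. rat_norm p (X m - X n) < e)"

definition padic_null :: "nat \<Rightarrow> (nat \<Rightarrow> rat) \<Rightarrow> bool" where
  "padic_null p X \<longleftrightarrow> (\<lambda>n. rat_norm p (X n)) \<longlonglongrightarrow> 0"

lemma padic_null_iff: "padic_null p X \<longleftrightarrow> (\<forall>e>0. \<exists>N. \<forall>n\<ge>N. rat_norm p (X n) < e)"
  by (simp add: padic_null_def LIMSEQ_iff rat_norm_nonneg)

lemma padic_null_const: "prime p \<Longrightarrow> padic_null p (\<lambda>n. a) \<longleftrightarrow> a = 0"
  by (auto simp: padic_null_def LIMSEQ_const_iff rat_norm_eq_0_iff)

lemma padic_null_le: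
  assumes "\<And>n. rat_norm p (X n) \<le> f n" "f \<longlonglongrightarrow> 0"
  shows "padic_null p X"
  unfolding padic_null_def
  by (rule tendsto_sandwich[OF _ _ tendsto_const assms(2)]) (auto simp: rat_norm_nonneg assms(1))

lemma padic_null_add:
  assumes "prime p" "padic_null p X" "padic_null p Y" shows "padic_null p (\<lambda>n. X n + Y n)"
  by (rule padic_null_le[OF rat_norm_add_le[OF assms(1)]])
     (use tendsto_add[OF assms(2,3)[unfolded padic_null_def]] in simp)

lemma padic_null_minus: "padic_null p X \<Longrightarrow> padic_null p (\<lambda>n. - X n)"
  by (simp add: padic_null_def rat_norm_minus)

lemma padic_cauchy_const: "padic_cauchy p (\<lambda>n. a)"
  by (simp add: padic_cauchy_def)

lemma padic_cauchy_minus: "padic_cauchy p X \<Longrightarrow> padic_cauchy p (\<lambda>n. - X n)"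
  unfolding padic_cauchy_def minus_diff_minus rat_norm_minus .

lemma padic_cauchy_add:
  assumes p: "prime p" and X: "padic_cauchy p X" and Y: "padic_cauchy p Y"
  shows "padic_cauchy p (\<lambda>n. X n + Y n)"
  unfolding padic_cauchy_def
proof (intro allI impI)
  fix e :: real assume e: "0 < e"
  obtain M where M: "\<forall>m\<ge>M. \<forall>n\<ge>M. rat_norm p (X m - X n) < e"
    using X e unfolding padic_cauchy_def by blast
  obtain N where N: "\<forall>m\<ge>N. \<forall>n\<ge>N. rat_norm p (Y m - Y n) < e"
    using Y e unfolding padic_cauchy_def by blast
  have "rat_norm p (X m + Y m - (X n + Y n)) < e" if "m \<ge> max M N" "n \<ge> max M N" for m n
    using rat_norm_add[OF p, of "X m - X n" "Y m - Y n"] M N that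
    by (simp add: add_diff_add) (smt (verit, best))
  then show "\<exists>N. \<forall>m\<ge>N. \<forall>n\<ge>N. rat_norm p (X m + Y m - (X n + Y n)) < e" by blast
qed

lemma padic_cauchy_norm_Cauchy:
  assumes p: "prime p" and X: "padic_cauchy p X"
  shows "Cauchy (\<lambda>n. rat_norm p (X n))"
  unfolding Cauchy_def dist_real_def
  using X rat_norm_diff_abs[OF p] unfolding padic_cauchy_def by (meson order_le_less_trans)

lemma padic_cauchy_bounded:
  assumes "prime p" "padic_cauchy p X"
  obtains B where "0 < B" "\<And>n. rat_norm p (X n) \<le> B"
proof -
  have "Bseq (\<lambda>n. rat_norm p (X n))"
    using padic_cauchy_norm_Cauchy[OF assms] by (rule Cauchy_Bseq)
  then show ?thesis using that by (auto simp: Bseq_def rat_norm_nonneg)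
qed

lemma padic_null_mult:
  assumes p: "prime p" and X: "padic_cauchy p X" and Y: "padic_null p Y"
  shows "padic_null p (\<lambda>n. X n * Y n)"
proof -
  obtain B where B: "0 < B" "\<And>n. rat_norm p (X n) \<le> B"
    using padic_cauchy_bounded[OF p X] by blast
  show ?thesis
  proof (rule padic_null_le)
    show "rat_norm p (X n * Y n) \<le> B * rat_norm p (Y n)" for n
      using B by (simp add: rat_norm_mult[OF p] mult_right_mono rat_norm_nonneg)
    show "(\<lambda>n. B * rat_norm p (Y n)) \<longlonglongrightarrow> 0"
      using tendsto_mult_right_zero[OF Y[unfolded padic_null_def]] .
  qed
qed

lemma padic_cauchy_mult:
  assumes p: "prime p" and X: "padic_cauchy p X" and Y: "padic_cauchy p Y"
  shows "padic_cauchy p (\<lambda>n. X n * Y n)"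
  unfolding padic_cauchy_def
proof (intro allI impI)
  fix e :: real assume e: "0 < e"
  obtain A where A: "0 < A" "\<And>n. rat_norm p (X n) \<le> A" using padic_cauchy_bounded[OF p X] by blast
  obtain B where B: "0 < B" "\<And>n. rat_norm p (Y n) \<le> B" using padic_cauchy_bounded[OF p Y] by blast
  obtain M where M: "\<forall>m\<ge>M. \<forall>n\<ge>M. rat_norm p (X m - X n) < e / B"
    using X e B unfolding padic_cauchy_def by (meson divide_pos_pos)
  obtain N where N: "\<forall>m\<ge>N. \<forall>n\<ge>N. rat_norm p (Y m - Y n) < e / A"
    using Y e A unfolding padic_cauchy_def by (meson divide_pos_pos)
  have "rat_norm p (X m * Y m - X n * Y n) < e" if mn: "m \<ge> max M N" "n \<ge> max M N" for m n
  proof -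
    have eq: "X m * Y m - X n * Y n = X m * (Y m - Y n) + (X m - X n) * Y n"
      by (simp add: algebra_simps)
    have "rat_norm p (X m * (Y m - Y n)) \<le> A * rat_norm p (Y m - Y n)"
      using A by (simp add: rat_norm_mult[OF p] mult_right_mono rat_norm_nonneg)
    also have "\<dots> < e" using N mn A by (simp add: field_simps)
    finally have 1: "rat_norm p (X m * (Y m - Y n)) < e" .
    have "rat_norm p ((X m - X n) * Y n) \<le> rat_norm p (X m - X n) * B"
      using B by (simp add: rat_norm_mult[OF p] mult_left_mono rat_norm_nonneg)
    also have "\<dots> < e" using M mn B by (simp add: field_simps)
    finally have 2: "rat_norm p ((X m - X n) * Y n) < e" .
    show ?thesis using rat_norm_add[OF p, of "X m * (Y m - Y n)" "(X m - X n) * Y n"] 1 2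
      unfolding eq by linarith
  qed
  then show "\<exists>N. \<forall>m\<ge>N. \<forall>n\<ge>N. rat_norm p (X m * Y m - X n * Y n) < e" by blast
qed

lemma padic_not_null:
  assumes p: "prime p" and X: "padic_cauchy p X" and nz: "\<not> padic_null p X"
  obtains e N where "0 < e" "\<And>n. n \<ge> N \<Longrightarrow> e \<le> rat_norm p (X n)"
proof -
  obtain e where e: "0 < e" and fr: "\<And>N. \<exists>m\<ge>N. e \<le> rat_norm p (X m)"
    using nz unfolding padic_null_iff by (auto simp: not_less)
  obtain N where N: "\<forall>m\<ge>N. \<forall>n\<ge>N. rat_norm p (X m - X n) < e"
    using X e unfolding padic_cauchy_def by blast
  have "e \<le> rat_norm p (X n)" if "n \<ge> N" for n
  proof -
    obtain m where "m \<ge> N" "e \<le> rat_norm p (X m)" using fr by blast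
    then show ?thesis using rat_norm_add[OF p, of "X m - X n" "X n"] N that by fastforce
  qed
  then show ?thesis using e that by blast
qed

lemma padic_cauchy_inverse:
  assumes p: "prime p" and X: "padic_cauchy p X" and nz: "\<not> padic_null p X"
  shows "padic_cauchy p (\<lambda>n. inverse (X n))"
  unfolding padic_cauchy_def
proof (intro allI impI)
  fix r :: real assume r: "0 < r"
  obtain e N where e: "0 < e" and N: "\<And>n. n \<ge> N \<Longrightarrow> e \<le> rat_norm p (X n)"
    using padic_not_null[OF p X nz] by blast
  have "0 < r * (e * e)" using r e by simp
  then obtain M where M: "\<forall>m\<ge>M. \<forall>n\<ge>M. rat_norm p (X m - X n) < r * (e * e)"
    using X unfolding padic_cauchy_def by blast
  have "rat_norm p (inverse (X m) - inverse (X n)) < r" if mn: "m \<ge> max M N" "n \<ge> max M N" for m n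
  proof -
    have em: "e \<le> rat_norm p (X m)" "e \<le> rat_norm p (X n)" using N mn by auto
    then have nz: "X m \<noteq> 0" "X n \<noteq> 0" using e by auto
    have eq: "inverse (X m) - inverse (X n) = (X n - X m) * (inverse (X m) * inverse (X n))"
      using nz by (simp add: field_simps)
    have ee: "e * e \<le> rat_norm p (X m) * rat_norm p (X n)"
      using em e by (intro mult_mono) auto
    have pos: "0 < rat_norm p (X m) * rat_norm p (X n)" using ee e by (meson less_le_trans mult_pos_pos)
    have "rat_norm p (X n - X m) < r * (e * e)" using M mn by auto
    also have "\<dots> \<le> r * (rat_norm p (X m) * rat_norm p (X n))" using ee r by simp
    finally show ?thesis
      unfolding eq rat_norm_mult[OF p] rat_norm_inverse[OF p] using pos
      by (simp add: field_simps flip: inverse_mult_distrib)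
  qed
  then show "\<exists>N. \<forall>m\<ge>N. \<forall>n\<ge>N. rat_norm p (inverse (X m) - inverse (X n)) < r" by blast
qed

lemma padic_null_inverse_mult:
  assumes p: "prime p" and X: "padic_cauchy p X" and nz: "\<not> padic_null p X"
  shows "padic_null p (\<lambda>n. inverse (X n) * X n - 1)"
proof -
  obtain e N where e: "0 < e" and N: "\<And>n. n \<ge> N \<Longrightarrow> e \<le> rat_norm p (X n)"
    using padic_not_null[OF p X nz] by blast
  have "inverse (X n) * X n - 1 = 0" if "n \<ge> N" for n
    using N[OF that] e by (cases "X n = 0") auto
  then show ?thesis unfolding padic_null_iff by (metis rat_norm_0)
qed

typedef (overloaded) 'a cauchy_seq = "{X. padic_cauchy CARD('a::prime_card) X}"
  using padic_cauchy_const by blast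

setup_lifting type_definition_cauchy_seq

instantiation cauchy_seq :: (prime_card) comm_ring_1
begin

lift_definition zero_cauchy_seq :: "'a cauchy_seq" is "\<lambda>n. 0"
  by (rule padic_cauchy_const)

lift_definition one_cauchy_seq :: "'a cauchy_seq" is "\<lambda>n. 1"
  by (rule padic_cauchy_const)

lift_definition plus_cauchy_seq :: "'a cauchy_seq \<Rightarrow> 'a cauchy_seq \<Rightarrow> 'a cauchy_seq"
  is "\<lambda>X Y n. X n + Y n"
  by (rule padic_cauchy_add[OF prime_card])

lift_definition uminus_cauchy_seq :: "'a cauchy_seq \<Rightarrow> 'a cauchy_seq" is "\<lambda>X n. - X n"
  by (rule padic_cauchy_minus)

lift_definition minus_cauchy_seq :: "'a cauchy_seq \<Rightarrow> 'a cauchy_seq \<Rightarrow> 'a cauchy_seq"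
  is "\<lambda>X Y n. X n - Y n"
  using padic_cauchy_add[OF prime_card _ padic_cauchy_minus] by fastforce

lift_definition times_cauchy_seq :: "'a cauchy_seq \<Rightarrow> 'a cauchy_seq \<Rightarrow> 'a cauchy_seq"
  is "\<lambda>X Y n. X n * Y n"
  by (rule padic_cauchy_mult[OF prime_card])

instance
proof
  show "(0::'a cauchy_seq) \<noteq> 1" by transfer (simp add: fun_eq_iff)
qed (transfer; simp add: algebra_simps; fail)+

end

lift_definition null_seq :: "'a::prime_card cauchy_seq \<Rightarrow> bool" is "padic_null CARD('a)" .

lift_definition inverse_seq :: "'a::prime_card cauchy_seq \<Rightarrow> 'a cauchy_seq"
  is "\<lambda>X. if padic_null CARD('a) X then (\<lambda>n. 0) else (\<lambda>n. inverse (X n))"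
  by (simp add: padic_cauchy_const padic_cauchy_inverse prime_card)

lift_definition norm_seq :: "'a::prime_card cauchy_seq \<Rightarrow> real"
  is "\<lambda>X. lim (\<lambda>n. rat_norm CARD('a) (X n))" .

lemma null_seq_0 [simp]: "null_seq 0"
  by transfer (simp add: padic_null_const[OF prime_card])

lemma null_seq_1 [simp]: "\<not> null_seq 1"
  by transfer (simp add: padic_null_const[OF prime_card])

lemma null_seq_add: "null_seq X \<Longrightarrow> null_seq Y \<Longrightarrow> null_seq (X + Y)"
  by transfer (rule padic_null_add[OF prime_card])

lemma null_seq_minus: "null_seq X \<Longrightarrow> null_seq (- X)"
  by transfer (rule padic_null_minus)

lemma null_seq_mult: "null_seq Y \<Longrightarrow> null_seq (X * Y)"
  by transfer (rule padic_null_mult[OF prime_card])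

lemma null_seq_inverse: "\<not> null_seq X \<Longrightarrow> null_seq (inverse_seq X * X - 1)"
  by transfer (simp add: padic_null_inverse_mult prime_card)

lemma norm_seq_LIMSEQ: "(\<lambda>n. rat_norm CARD('a) (Rep_cauchy_seq X n)) \<longlonglongrightarrow> norm_seq X"
  for X :: "'a::prime_card cauchy_seq"
  using padic_cauchy_norm_Cauchy[OF prime_card[where 'a = 'a], of "Rep_cauchy_seq X"] Rep_cauchy_seq[of X]
  by (simp add: norm_seq.rep_eq Cauchy_convergent convergent_LIMSEQ_iff[symmetric])

lemma norm_seq_eq_0_iff: "norm_seq X = 0 \<longleftrightarrow> null_seq X"
  using norm_seq_LIMSEQ[of X] LIMSEQ_unique by (auto simp: null_seq.rep_eq padic_null_def)

lemma norm_seq_add_le: "norm_seq (X + Y) \<le> norm_seq X + norm_seq Y"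
  by (rule LIMSEQ_le[OF norm_seq_LIMSEQ tendsto_add[OF norm_seq_LIMSEQ norm_seq_LIMSEQ]])
     (auto simp: plus_cauchy_seq.rep_eq rat_norm_add_le[OF prime_card])

lemma norm_seq_minus: "norm_seq (- X) = norm_seq X"
  by transfer (simp add: rat_norm_minus)

definition padic_rel :: "'a::prime_card cauchy_seq \<Rightarrow> 'a cauchy_seq \<Rightarrow> bool" where
  "padic_rel X Y \<longleftrightarrow> null_seq (X - Y)"

lemma padic_rel_sym: "padic_rel X Y \<Longrightarrow> padic_rel Y X"
  using null_seq_minus[of "X - Y"] by (simp add: padic_rel_def)

quotient_type (overloaded) 'a padic = "'a::prime_card cauchy_seq" / padic_rel
proof (rule equivpI)
  show "reflp (padic_rel :: 'a cauchy_seq \<Rightarrow> _)" by (rule reflpI) (simp add: padic_rel_def)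
  show "symp (padic_rel :: 'a cauchy_seq \<Rightarrow> _)" by (rule sympI) (rule padic_rel_sym)
  show "transp (padic_rel :: 'a cauchy_seq \<Rightarrow> _)"
  proof (rule transpI)
    fix X Y Z :: "'a cauchy_seq" assume "padic_rel X Y" "padic_rel Y Z"
    then show "padic_rel X Z"
      using null_seq_add[of "X - Y" "Y - Z"] by (simp add: padic_rel_def)
  qed
qed

lemma padic_rel_null_seq: "padic_rel X Y \<Longrightarrow> null_seq X \<Longrightarrow> null_seq Y"
  using null_seq_add[of "- (X - Y)" X] null_seq_minus[of "X - Y"] by (simp add: padic_rel_def)

instantiation padic :: (prime_card) field
begin

lift_definition zero_padic :: "'a padic" is 0 .

lift_definition one_padic :: "'a padic" is 1 .

lift_definition plus_padic :: "'a padic \<Rightarrow> 'a padic \<Rightarrow> 'a padic" is "(+)"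
  unfolding padic_rel_def add_diff_add by (rule null_seq_add)

lift_definition uminus_padic :: "'a padic \<Rightarrow> 'a padic" is "uminus"
  unfolding padic_rel_def minus_diff_minus by (rule null_seq_minus)

lift_definition minus_padic :: "'a padic \<Rightarrow> 'a padic \<Rightarrow> 'a padic" is "(-)"
proof -
  fix A B C D :: "'a cauchy_seq"
  assume "padic_rel A B" "padic_rel C D"
  then have "null_seq ((A - B) + - (C - D))"
    unfolding padic_rel_def by (intro null_seq_add null_seq_minus)
  then show "padic_rel (A - C) (B - D)" by (simp add: padic_rel_def algebra_simps)
qed

lift_definition times_padic :: "'a padic \<Rightarrow> 'a padic \<Rightarrow> 'a padic" is "(*)"
proof -
  fix A B C D :: "'a cauchy_seq"
  assume "padic_rel A B" "padic_rel C D"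
  then have "null_seq (A * (C - D) + D * (A - B))"
    unfolding padic_rel_def by (intro null_seq_add null_seq_mult)
  then show "padic_rel (A * C) (B * D)" by (simp add: padic_rel_def algebra_simps)
qed

lift_definition inverse_padic :: "'a padic \<Rightarrow> 'a padic" is inverse_seq
proof -
  fix X Y :: "'a cauchy_seq"
  assume XY: "padic_rel X Y"
  show "padic_rel (inverse_seq X) (inverse_seq Y)"
  proof (cases "null_seq X")
    case True
    then have "null_seq Y" using padic_rel_null_seq[OF XY] by simp
    then have "inverse_seq X = inverse_seq Y" using True by transfer simp
    then show ?thesis by (simp add: padic_rel_def)
  next
    case False
    then have nY: "\<not> null_seq Y" using padic_rel_null_seq[OF padic_rel_sym[OF XY]] by blast
    let ?x = "inverse_seq X" and ?y = "inverse_seq Y"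
    have "null_seq (?y * (?x * X - 1) + (- (?x * (?y * Y - 1)) + - ((?x * ?y) * (X - Y))))"
      using XY unfolding padic_rel_def
      by (intro null_seq_add null_seq_minus null_seq_mult null_seq_inverse False nY)
    then show ?thesis by (simp add: padic_rel_def algebra_simps)
  qed
qed

definition "x div y = x * inverse y" for x y :: "'a padic"

instance
proof
  note [simp] = padic_rel_def
  fix a b c :: "'a padic"
  show "a + b = b + a" by transfer (simp add: ac_simps)
  show "(a + b) + c = a + (b + c)" by transfer (simp add: ac_simps)
  show "0 + a = a" by transfer simp
  show "- a + a = 0" by transfer simp
  show "a - b = a + - b" by transfer simp
  show "(a * b) * c = a * (b * c)" by transfer (simp add: ac_simps)
  show "a * b = b * a" by transfer (simp add: ac_simps)
  show "1 * a = a" by transfer simp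
  show "(a + b) * c = a * c + b * c" by transfer (simp add: distrib_right)
  show "(0::'a padic) \<noteq> 1" by transfer (use null_seq_minus in fastforce)
  show "inverse a * a = 1" if "a \<noteq> 0" using that by transfer (simp add: null_seq_inverse)
  show "a div b = a * inverse b" by (rule divide_padic_def)
  show "inverse (0::'a padic) = 0"
  proof transfer
    have "inverse_seq (0 :: 'a cauchy_seq) = 0"
      by transfer (simp add: padic_null_const[OF prime_card])
    then show "padic_rel (inverse_seq (0 :: 'a cauchy_seq)) 0" by simp
  qed
qed

end

lemma of_nat_padic: "of_nat k = abs_padic (of_nat k)"
  by (induction k) (simp_all add: zero_padic_def one_padic_def plus_padic.abs_eq)

lemma null_seq_of_nat: "null_seq (of_nat k :: 'a::prime_card cauchy_seq) \<longleftrightarrow> k = 0"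
proof -
  have "Rep_cauchy_seq (of_nat k :: 'a cauchy_seq) = (\<lambda>n. of_nat k)"
    by (induction k)
       (simp_all add: zero_cauchy_seq.rep_eq one_cauchy_seq.rep_eq plus_cauchy_seq.rep_eq)
  then show ?thesis by (simp add: null_seq.rep_eq padic_null_const[OF prime_card])
qed

instance padic :: (prime_card) field_char_0
proof
  show "inj (of_nat :: nat \<Rightarrow> 'a padic)"
  proof (rule linorder_inj_onI')
    fix i j :: nat assume ij: "i < j"
    then have "(of_nat j :: 'a padic) = of_nat i + of_nat (j - i)"
      by (simp flip: of_nat_add)
    moreover have "(of_nat (j - i) :: 'a padic) \<noteq> 0"
      using ij null_seq_of_nat[of "j - i", where 'a = 'a]
      by (auto simp: of_nat_padic zero_padic_def padic.abs_eq_iff padic_rel_def simp del: of_nat_diff)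
    ultimately show "(of_nat i :: 'a padic) \<noteq> of_nat j" by auto
  qed
qed

lift_definition padic_norm :: "'a::prime_card padic \<Rightarrow> real" is norm_seq
proof -
  fix X Y :: "'a cauchy_seq"
  assume "padic_rel X Y"
  then have "norm_seq (X - Y) = 0" "norm_seq (Y - X) = 0"
    using padic_rel_sym by (auto simp: padic_rel_def norm_seq_eq_0_iff)
  then show "norm_seq X = norm_seq Y"
    using norm_seq_add_le[of "X - Y" Y] norm_seq_add_le[of "Y - X" X] by simp
qed

instantiation padic :: (prime_card) metric_space
begin

definition "dist x y = padic_norm (x - y)" for x y :: "'a padic"

definition "(uniformity :: ('a padic \<times> 'a padic) filter)
  = (INF e\<in>{0<..}. principal {(x, y). dist x y < e})"

definition "open U \<longleftrightarrow> (\<forall>x\<in>U. eventually (\<lambda>(x', y). x' = x \<longrightarrow> y \<in> U) uniformity)"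
  for U :: "'a padic set"

instance
proof
  fix x y z :: "'a padic" and U :: "'a padic set"
  show "(uniformity :: ('a padic \<times> 'a padic) filter)
      = (INF e\<in>{0<..}. principal {(x, y). dist x y < e})" by (rule uniformity_padic_def)
  show "open U \<longleftrightarrow> (\<forall>x\<in>U. eventually (\<lambda>(x', y). x' = x \<longrightarrow> y \<in> U) uniformity)"
    by (rule open_padic_def)
  show "dist x y = 0 \<longleftrightarrow> x = y"
    unfolding dist_padic_def by transfer (simp add: norm_seq_eq_0_iff padic_rel_def)
  have "padic_norm (a + b) \<le> padic_norm a + padic_norm b" for a b :: "'a padic"
    by transfer (rule norm_seq_add_le)
  from this[of "x - z" "- (y - z)"]
  have "padic_norm (x - y) \<le> padic_norm (x - z) + padic_norm (- (y - z))" by simp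
  moreover have "padic_norm (- a) = padic_norm a" for a :: "'a padic"
    by transfer (rule norm_seq_minus)
  ultimately show "dist x y \<le> dist x z + dist y z"
    unfolding dist_padic_def by metis
qed

end

lift_definition const_seq :: "rat \<Rightarrow> 'a::prime_card cauchy_seq" is "\<lambda>r n. r"
  by (rule padic_cauchy_const)

lemma of_rat_padic: "of_rat r = abs_padic (const_seq r)"
proof -
  let ?c = "\<lambda>r. abs_padic (const_seq r) :: 'a padic"
  have "?c 0 = 0" "?c 1 = 1"
    unfolding zero_padic_def one_padic_def by (simp_all add: const_seq_def zero_cauchy_seq_def one_cauchy_seq_def)
  have add: "?c (r + s) = ?c r + ?c s" for r s
    unfolding plus_padic.abs_eq by (rule arg_cong[where f = abs_padic]) (transfer, simp)
  have mult: "?c (r * s) = ?c r * ?c s" for r s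
    unfolding times_padic.abs_eq by (rule arg_cong[where f = abs_padic]) (transfer, simp)
  have nat: "?c (of_nat k) = of_nat k" for k
    by (induction k) (simp_all add: add \<open>?c 0 = 0\<close> \<open>?c 1 = 1\<close>)
  have minus: "?c (- r) = - ?c r" for r
    using add[of "- r" r] \<open>?c 0 = 0\<close> by (simp add: eq_neg_iff_add_eq_0)
  have int: "?c (of_int k) = of_int k" for k
    by (cases k rule: int_cases2) (simp_all add: nat minus)
  obtain a b where r: "b \<noteq> 0" "r = of_int a / of_int b" using rat_as_div by blast
  have "?c r * ?c (of_int b) = ?c (of_int a)" using r by (simp flip: mult)
  then have "?c r * of_int b = of_int a" by (simp only: int)
  then have "?c r = of_int a / of_int b" using r(1) by (simp add: eq_divide_eq)
  then show ?thesis using r by (simp add: of_rat_divide)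
qed

lemma padic_norm_of_rat: "padic_norm (of_rat r :: 'a::prime_card padic) = rat_norm CARD('a) r"
  unfolding of_rat_padic padic_norm.abs_eq by transfer simp

text \<open>
  \<open>'p padic ^ 'n\<close> carries the product topology, which is the topology of the maximum norm.
\<close>

definition unit_ball :: "('p::prime_card padic ^ 'n) set" where
  "unit_ball = {x. \<forall>i. padic_norm (x $ i) \<le> 1}"

definition normalized_haar :: "('p::prime_card padic ^ 'n) measure \<Rightarrow> bool" where
  "normalized_haar \<mu> \<longleftrightarrow> sets \<mu> = sets borel
     \<and> (\<forall>a. \<forall>A\<in>sets borel. emeasure \<mu> ((\<lambda>x. a + x) ` A) = emeasure \<mu> A)
     \<and> emeasure \<mu> unit_ball = 1"

text \<open>The fractional part is the unique element of \<open>\<int>[1/p] \<inter> [0,1)\<close> congruent to \<open>y\<close> modulo \<open>\<int>\<^sub>p\<close>.\<close>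

definition padic_frac :: "'p::prime_card padic \<Rightarrow> rat" where
  "padic_frac y = (THE r. 0 \<le> r \<and> r < 1 \<and> (\<exists>m k. r = of_nat m / of_nat CARD('p) ^ k)
     \<and> padic_norm (y - of_rat r) \<le> 1)"

definition padic_char :: "'p::prime_card padic \<Rightarrow> complex" where
  "padic_char y = exp (2 * of_real pi * \<i> * of_rat (padic_frac y))"

definition dot :: "'a::comm_semiring_0 ^ 'n \<Rightarrow> 'a ^ 'n \<Rightarrow> 'a" where
  "dot x \<xi> = (\<Sum>j\<in>UNIV. x $ j * \<xi> $ j)"

text \<open>
  A polynomial in the variables indexed by \<open>'n\<close> is a finitely supported map from exponent vectors
  to coefficients.
\<close>

type_synonym ('n, 'a) mpoly = "('n \<Rightarrow>\<^sub>0 nat) \<Rightarrow>\<^sub>0 'a"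

definition mpoly_eval :: "('n::finite, 'a::comm_semiring_1) mpoly \<Rightarrow> 'a ^ 'n \<Rightarrow> 'a" where
  "mpoly_eval f x = (\<Sum>m\<in>Poly_Mapping.keys f.
     Poly_Mapping.lookup f m * (\<Prod>i\<in>UNIV. x $ i ^ Poly_Mapping.lookup m i))"

definition homogeneous :: "nat \<Rightarrow> ('n::finite, 'a::zero) mpoly \<Rightarrow> bool" where
  "homogeneous d f \<longleftrightarrow> (\<forall>m\<in>Poly_Mapping.keys f. (\<Sum>i\<in>UNIV. Poly_Mapping.lookup m i) = d)"

definition elliptic :: "nat \<Rightarrow> ('n::finite, 'p::prime_card padic) mpoly \<Rightarrow> bool" where
  "elliptic d f \<longleftrightarrow> (\<exists>m\<in>Poly_Mapping.keys f. m \<noteq> 0) \<and> homogeneous d f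
     \<and> (\<forall>\<xi>. mpoly_eval f \<xi> = 0 \<longleftrightarrow> \<xi> = 0)"

definition integral_coeffs :: "('n, 'p::prime_card padic) mpoly \<Rightarrow> bool" where
  "integral_coeffs f \<longleftrightarrow> (\<forall>m. padic_norm (Poly_Mapping.lookup f m) \<le> 1)"

definition symbol :: "('n::finite, 'p::prime_card padic) mpoly \<Rightarrow> real \<Rightarrow> 'p padic ^ 'n \<Rightarrow> real" where
  "symbol f \<beta> \<xi> = padic_norm (mpoly_eval f \<xi>) powr \<beta>"

definition heat_kernel :: "('p::prime_card padic ^ 'n) measure \<Rightarrow> ('n::finite, 'p padic) mpoly
    \<Rightarrow> real \<Rightarrow> real \<Rightarrow> 'p padic ^ 'n \<Rightarrow> complex" where
  "heat_kernel \<mu> f \<beta> t x =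
     (LINT \<xi>|\<mu>. padic_char (- dot x \<xi>) * of_real (exp (- t * symbol f \<beta> \<xi>)))"

text \<open>
  The heat kernel is real valued because \<open>symbol f \<beta>\<close> is even, and it is non-negative when
  \<open>Z\<^sub>t d\<^sup>nx\<close> is a convolution semigroup; \<open>Re\<close> and \<open>ennreal\<close> are then mere coercions.
\<close>

definition heat_measure :: "('p::prime_card padic ^ 'n) measure \<Rightarrow> ('n::finite, 'p padic) mpoly
    \<Rightarrow> real \<Rightarrow> real \<Rightarrow> ('p padic ^ 'n) measure" where
  "heat_measure \<mu> f \<beta> t = density \<mu> (\<lambda>x. ennreal (Re (heat_kernel \<mu> f \<beta> t x)))"

definition radon_on :: "'a::topological_space set \<Rightarrow> 'a measure \<Rightarrow> bool" where
  "radon_on X M \<longleftrightarrow> sets M = sets (restrict_space borel X)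
     \<and> (\<forall>K. compact K \<and> K \<subseteq> X \<longrightarrow> emeasure M K < \<infinity>)"

definition Cc_on :: "'a::topological_space set \<Rightarrow> ('a \<Rightarrow> real) set" where
  "Cc_on X = {\<phi>. continuous_on X \<phi> \<and> (\<exists>K. compact K \<and> K \<subseteq> X \<and> (\<forall>x\<in>X - K. \<phi> x = 0))}"

definition vague_limit_on :: "'a::topological_space set \<Rightarrow> ('b \<Rightarrow> 'a measure) \<Rightarrow> 'a measure
    \<Rightarrow> 'b filter \<Rightarrow> bool" where
  "vague_limit_on X M N F \<longleftrightarrow> (\<forall>\<phi>\<in>Cc_on X. ((\<lambda>t. LINT x|M t. \<phi> x) \<longlongrightarrow> (LINT x|N. \<phi> x)) F)"

definition levy_measure :: "(real \<Rightarrow> 'a measure) \<Rightarrow> 'a::{topological_space, zero} measure \<Rightarrow> bool" where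
  "levy_measure \<mu> Z \<longleftrightarrow> radon_on (- {0}) Z
     \<and> vague_limit_on (- {0})
         (\<lambda>t. scale_measure (ennreal (1 / t)) (restrict_space (\<mu> t) (- {0}))) Z (at_right 0)"

definition quadratic_form :: "('a::ab_group_add \<Rightarrow> real) \<Rightarrow> bool" where
  "quadratic_form q \<longleftrightarrow> (\<forall>x \<xi>. 2 * q x + 2 * q \<xi> = q (x + \<xi>) + q (x - \<xi>))"

definition additive_hom :: "('a::ab_group_add \<Rightarrow> real) \<Rightarrow> bool" where
  "additive_hom l \<longleftrightarrow> (\<forall>x y. l (x + y) = l x + l y)"

end

theory Submission
  imports Defs
begin

text \<open>
  All three conditions fail. For (iii), a quadratic form is multiplied by \<open>p\<^sup>2\<close> under \<open>\<xi> \<mapsto> p\<xi>\<close>, whereas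
  \<open>|f|\<^sup>\<beta>\<close> is divided by \<open>g = p powr (d\<beta>) > 1\<close>.

  For (i) and (ii), let \<open>B(k)\<close> be the ball of radius \<open>p powr k\<close>, \<open>A = exp (- t |f|\<^sup>\<beta>)\<close>, and \<open>\<phi>\<close> the
  indicator of the compact shell \<open>B(N) - B(0)\<close>. By Fubini and orthogonality of the character on
  balls, the integral of \<open>\<phi> Z\<^sub>t\<close> is the mean of \<open>A\<close> over \<open>B(-N)\<close> minus its mean over \<open>B(0)\<close>. The first
  mean is at least \<open>1 - t / g ^ N\<close> because \<open>f\<close> has integral coefficients; the second is at most
  \<open>1 - t\<delta>\<close> for \<open>t \<le> 1\<close>, with \<open>\<delta> > 0\<close> independent of \<open>N\<close>, because \<open>|f|\<close> is bounded below on the compact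
  set \<open>B(0) - B(-1)\<close>. For \<open>N\<close> large the difference is at least \<open>t\<delta>/2\<close>. The density used in
  \<open>heat_measure\<close> is the positive part of \<open>Re Z\<^sub>t\<close>, which dominates \<open>Re Z\<^sub>t\<close>, so the argument does not
  need \<open>Z\<^sub>t \<ge> 0\<close>.
\<close>

section \<open>The p-adic absolute value\<close>

lemma padic_norm_0 [simp]: "padic_norm 0 = 0"
  by (metis diff_self dist_padic_def dist_self)

lemma padic_norm_nonneg [simp]: "0 \<le> padic_norm x"
  using zero_le_dist[of x 0] by (simp add: dist_padic_def)

lemma padic_norm_eq_0_iff [simp]: "padic_norm x = 0 \<longleftrightarrow> x = 0"
  using dist_eq_0_iff[of x 0] by (simp add: dist_padic_def)

lemma padic_norm_minus [simp]: "padic_norm (- x) = padic_norm x"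
  by transfer (rule norm_seq_minus)

lemma padic_norm_diff_commute: "padic_norm (x - y) = padic_norm (y - x)"
  using padic_norm_minus[of "x - y"] by simp

text \<open>Density of the rationals: a late term of a Cauchy sequence representing \<open>x\<close>
  is close to \<open>x\<close>.\<close>

lemma padic_norm_of_rat_approx:
  fixes x :: "'p::prime_card padic"
  assumes "e > 0"
  shows "\<exists>r. padic_norm (x - of_rat r) < e"
proof -
  obtain X where x: "x = abs_padic X" by (metis Quotient_abs_rep Quotient_padic)
  have "padic_cauchy CARD('p) (Rep_cauchy_seq X)" using Rep_cauchy_seq[of X] by simp
  \<comment> \<open>Half of \<open>e\<close>, because passing to the limit weakens the strict bound
    to \<open>\<le>\<close>.\<close>
  then obtain N where N: "\<forall>m\<ge>N. \<forall>n\<ge>N. rat_norm CARD('p) (Rep_cauchy_seq X m - Rep_cauchy_seq X n) < e / 2"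
    using assms unfolding padic_cauchy_def by (meson half_gt_zero)
  let ?r = "Rep_cauchy_seq X N"
  have "padic_norm (x - of_rat ?r) = norm_seq (X - const_seq ?r)"
    by (simp add: x of_rat_padic minus_padic.abs_eq padic_norm.abs_eq)
  also have "\<dots> \<le> e / 2"
    by (rule LIMSEQ_le_const2[OF norm_seq_LIMSEQ])
       (use N in \<open>force simp: minus_cauchy_seq.rep_eq const_seq.rep_eq intro: less_imp_le\<close>)
  also have "\<dots> < e" using assms by simp
  finally show ?thesis by blast
qed

lemma padic_norm_add: "padic_norm (x + y) \<le> max (padic_norm x) (padic_norm y)"
  for x y :: "'p::prime_card padic"
proof transfer
  fix X Y :: "'p cauchy_seq"
  show "norm_seq (X + Y) \<le> max (norm_seq X) (norm_seq Y)"
    by (rule LIMSEQ_le[OF norm_seq_LIMSEQ tendsto_max[OF norm_seq_LIMSEQ norm_seq_LIMSEQ]])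
       (auto simp: plus_cauchy_seq.rep_eq intro!: rat_norm_add[OF prime_card])
qed

lemma padic_norm_add_le: "padic_norm x \<le> r \<Longrightarrow> padic_norm y \<le> r \<Longrightarrow> padic_norm (x + y) \<le> r"
  using padic_norm_add[of x y] by linarith

lemma padic_norm_diff_le: "padic_norm x \<le> r \<Longrightarrow> padic_norm y \<le> r \<Longrightarrow> padic_norm (x - y) \<le> r"
  using padic_norm_add_le[of x r "- y"] by simp

lemma padic_norm_sum_le:
  assumes "\<And>i. i \<in> I \<Longrightarrow> padic_norm (g i) \<le> r" "0 \<le> r"
  shows "padic_norm (sum g I) \<le> r"
  using assms by (induction I rule: infinite_finite_induct) (auto intro: padic_norm_add_le)

lemma padic_norm_mult: "padic_norm (x * y) = padic_norm x * padic_norm y"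
  for x y :: "'p::prime_card padic"
proof transfer
  fix X Y :: "'p cauchy_seq"
  show "norm_seq (X * Y) = norm_seq X * norm_seq Y"
    by (rule LIMSEQ_unique[OF norm_seq_LIMSEQ])
       (use tendsto_mult[OF norm_seq_LIMSEQ[of X] norm_seq_LIMSEQ[of Y]]
         in \<open>simp add: times_cauchy_seq.rep_eq rat_norm_mult[OF prime_card]\<close>)
qed

lemma padic_norm_1 [simp]: "padic_norm (1 :: 'p::prime_card padic) = 1"
  using padic_norm_of_rat[of 1, where 'a = 'p] by (simp add: rat_norm_1 prime_card)

lemma padic_norm_power: "padic_norm (x ^ k) = padic_norm x ^ k"
  by (induction k) (simp_all add: padic_norm_mult)

lemma padic_norm_inverse: "padic_norm (inverse x) = inverse (padic_norm x)"
proof (cases "x = 0")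
  case False
  then have "padic_norm x * padic_norm (inverse x) = 1" by (simp flip: padic_norm_mult)
  then show ?thesis by (metis inverse_unique)
qed simp

lemma padic_norm_prod: "padic_norm (prod g I) = (\<Prod>i\<in>I. padic_norm (g i))"
  by (induction I rule: infinite_finite_induct) (auto simp: padic_norm_mult)

lemma padic_norm_power_int: "padic_norm (x powi k) = padic_norm x powi k"
  by (cases k) (simp_all add: power_int_def padic_norm_power padic_norm_inverse)

lemma prime_card_gt_1: "real CARD('p::prime_card) > 1"
  using prime_gt_1_nat[OF prime_card] by simp

section \<open>Divisibility by powers of p and approximation by integers\<close>

lemma padic_norm_of_int: "padic_norm (of_int a :: 'p::prime_card padic)
    = (if a = 0 then 0 else real CARD('p) powi - int (multiplicity (int CARD('p)) a))"
  using rat_norm_of_int_div[OF prime_card[where 'a='p], of a 1] padic_norm_of_rat[of "of_int a", where 'a = 'p]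
  by simp

text \<open>Norm bounds on integers become congruences, which is how residues and fractional parts
  are controlled below.\<close>

lemma padic_norm_of_int_le_iff:
  "padic_norm (of_int a :: 'p::prime_card padic) \<le> real CARD('p) powi - int k \<longleftrightarrow> int CARD('p) ^ k dvd a"
proof (cases "a = 0")
  case False
  have "\<not> is_unit (int CARD('p))" using prime_gt_1_nat[OF prime_card[where 'a='p]] by auto
  then have "int CARD('p) ^ k dvd a \<longleftrightarrow> k \<le> multiplicity (int CARD('p)) a"
    using False by (intro power_dvd_iff_le_multiplicity) auto
  then show ?thesis
    using False power_int_increasing[of "- int (multiplicity (int CARD('p)) a)" "- int k" "real CARD('p)"]
      power_int_strict_increasing[of "- int k" "- int (multiplicity (int CARD('p)) a)" "real CARD('p)"]
      prime_card_gt_1[where 'p='p]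
    by (cases "k \<le> multiplicity (int CARD('p)) a") (auto simp: padic_norm_of_int)
qed (use prime_card_gt_1[where 'p='p] in auto)

lemma padic_norm_card: "padic_norm (of_nat CARD('p) :: 'p::prime_card padic) = inverse (real CARD('p))"
proof -
  have "CARD('p) \<noteq> 0" by simp
  moreover have "multiplicity (int CARD('p)) (int CARD('p)) = 1"
    using prime_gt_1_nat[OF prime_card[where 'a='p]] by (intro multiplicity_self) auto
  ultimately show ?thesis
    using padic_norm_of_int[of "int CARD('p)", where 'p='p] by (simp add: power_int_minus)
qed

lemma padic_norm_card_powi:
  "padic_norm (of_nat CARD('p) powi k :: 'p::prime_card padic) = real CARD('p) powi - k"
  by (simp add: padic_norm_power_int padic_norm_card power_int_inverse power_int_minus)

text \<open>A rational \<open>a / b\<close> close to \<open>x\<close> has norm at most 1, so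
  \<open>p\<close> does not divide \<open>b\<close> and \<open>b\<close> can be inverted modulo
  \<open>p ^ k\<close>; \<open>m\<close> is the residue of \<open>a / b\<close>. The lemma supplies
  finite nets, fractional parts and digits.\<close>

lemma padic_integer_approx:
  fixes x :: "'p::prime_card padic"
  assumes "padic_norm x \<le> 1"
  shows "\<exists>m < CARD('p) ^ k. padic_norm (x - of_nat m) \<le> real CARD('p) powi - int k"
proof -
  let ?p = "int CARD('p)"
  have pr: "prime ?p" using prime_card[where 'a='p] by simp
  have pos: "0 < real CARD('p) powi - int k" by simp
  then obtain r where r: "padic_norm (x - of_rat r) < real CARD('p) powi - int k"
    using padic_norm_of_rat_approx by blast
  obtain a b where ab: "quotient_of r = (a, b)" by fastforce
  have b: "b > 0" using quotient_of_denom_pos[OF ab] .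
  have r_eq: "r = of_int a / of_int b" using quotient_of_div[OF ab] .
  have le1: "real CARD('p) powi - int k \<le> 1"
    using prime_card_gt_1[where 'p='p] by (simp add: power_int_minus inverse_le_1_iff)
  have nr: "padic_norm (of_rat r :: 'p padic) \<le> 1"
    using padic_norm_diff_le[OF assms, of "x - of_rat r"] r le1 by simp
  \<comment> \<open>In lowest terms, a factor \<open>p\<close> of \<open>b\<close> cannot divide
    \<open>a\<close>, so it would push the norm of \<open>r\<close> above 1.\<close>
  have cop: "coprime ?p b"
  proof (rule ccontr)
    assume "\<not> coprime ?p b"
    then have pb: "?p dvd b" using pr by (meson prime_imp_coprime)
    have "coprime a b" using quotient_of_coprime[OF ab] .
    then have "\<not> ?p dvd a" using pb pr by (meson coprime_common_divisor not_prime_unit)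
    then have "a \<noteq> 0" "multiplicity ?p a = 0" by (auto simp: not_dvd_imp_multiplicity_0)
    moreover have "multiplicity ?p b > 0"
      using pb b pr by (simp add: prime_multiplicity_gt_zero_iff)
    ultimately have "padic_norm (of_rat r :: 'p padic) > 1"
      using prime_card_gt_1[where 'p='p] b
      by (simp add: padic_norm_of_rat r_eq rat_norm_of_int_div[OF prime_card[where 'a='p]] one_less_power)
    then show False using nr by simp
  qed
  then have "coprime b (?p ^ k)" by (simp add: coprime_commute)
  \<comment> \<open>\<open>c\<close> is an inverse of \<open>b\<close> modulo
    \<open>p ^ k\<close>.\<close>
  then obtain c v where c: "c * b + v * ?p ^ k = 1"
    using bezout_int[of b "?p ^ k"] by auto
  define m where "m = nat ((a * c) mod ?p ^ k)"
  have pk: "?p ^ k > 0" by simp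
  have m: "int m = (a * c) mod ?p ^ k" using pk by (simp add: m_def)
  have "int m < ?p ^ k" unfolding m using pk by simp
  then have "m < CARD('p) ^ k" by (metis of_nat_less_iff of_nat_power)
  \<comment> \<open>The last term is \<open>a\<close> times the Bezout combination, which equals 1;
    in this form \<open>?p ^ k\<close> factors out.\<close>
  have "b * int m - a = b * (a * c - ?p ^ k * (a * c div ?p ^ k)) - a * (c * b + v * ?p ^ k)"
    unfolding m c by (simp add: minus_mult_div_eq_mod)
  also have "\<dots> = ?p ^ k * (- b * (a * c div ?p ^ k) - a * v)" by (simp add: algebra_simps)
  finally have "?p ^ k dvd b * int m - a" by simp
  then have n1: "padic_norm (of_int (b * int m - a) :: 'p padic) \<le> real CARD('p) powi - int k"
    by (simp only: padic_norm_of_int_le_iff)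
  have nb: "padic_norm (of_int b :: 'p padic) = 1"
  proof -
    have "\<not> ?p dvd b" using cop pr by (meson coprime_common_divisor dvd_refl not_prime_unit)
    then show ?thesis using b by (simp add: padic_norm_of_int not_dvd_imp_multiplicity_0)
  qed
  have "of_int b * (of_nat m - of_rat r :: 'p padic) = of_int (b * int m - a)"
    using b by (simp add: r_eq of_rat_divide field_simps)
  then have "padic_norm (of_nat m - of_rat r :: 'p padic) \<le> real CARD('p) powi - int k"
    using n1 nb by (metis padic_norm_mult mult_1)
  then have "padic_norm ((x - of_rat r) - (of_nat m - of_rat r)) \<le> real CARD('p) powi - int k"
    using r by (intro padic_norm_diff_le[of "x - of_rat r"]) auto
  then have "padic_norm (x - of_nat m) \<le> real CARD('p) powi - int k" by simp
  then show ?thesis using \<open>m < CARD('p) ^ k\<close> by blast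
qed

lemma padic_norm_bounded:
  obtains k :: nat where "padic_norm (x :: 'p::prime_card padic) \<le> real CARD('p) ^ k"
  using real_arch_pow[OF prime_card_gt_1[where 'p='p], of "padic_norm x"] by (metis less_imp_le)

section \<open>The topology of the p-adic numbers\<close>

lemma padic_norm_triangle: "padic_norm (x + y) \<le> padic_norm x + padic_norm y"
  using padic_norm_add[of x y] padic_norm_nonneg[of x] padic_norm_nonneg[of y] by linarith

lemma tendsto_padic_iff:
  "(g \<longlongrightarrow> l) F \<longleftrightarrow> ((\<lambda>x. padic_norm (g x - l)) \<longlongrightarrow> 0) F"
  by (subst tendsto_dist_iff) (simp add: dist_padic_def)

instance padic :: (prime_card) topological_ab_group_add
proof
  fix a b :: "'a padic"
  have "((\<lambda>x. padic_norm (fst x + snd x - (a + b))) \<longlongrightarrow> 0) (nhds a \<times>\<^sub>F nhds b)"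
  proof (rule tendsto_sandwich[OF _ _ tendsto_const])
    have "((\<lambda>x. dist (fst x) a + dist (snd x) b) \<longlongrightarrow> dist a a + dist b b) (nhds a \<times>\<^sub>F nhds b)"
      by (intro tendsto_intros filterlim_fst filterlim_snd)
    then show "((\<lambda>x. padic_norm (fst x - a) + padic_norm (snd x - b)) \<longlongrightarrow> 0) (nhds a \<times>\<^sub>F nhds b)"
      by (simp add: dist_padic_def)
    show "\<forall>\<^sub>F x in nhds a \<times>\<^sub>F nhds b. padic_norm (fst x + snd x - (a + b))
        \<le> padic_norm (fst x - a) + padic_norm (snd x - b)"
      by (intro always_eventually allI) (metis add_diff_add padic_norm_triangle)
  qed simp
  then show "((\<lambda>x. fst x + snd x) \<longlongrightarrow> a + b) (nhds a \<times>\<^sub>F nhds b)"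
    by (simp only: tendsto_padic_iff)
  have "((\<lambda>x. dist x a) \<longlongrightarrow> dist a a) (nhds a)"
    by (intro tendsto_intros filterlim_ident)
  then show "(uminus \<longlongrightarrow> - a) (nhds a)"
    by (simp add: tendsto_padic_iff dist_padic_def padic_norm_diff_commute)
qed

instance padic :: (prime_card) topological_comm_monoid_mult
proof
  fix a b :: "'a padic"
  let ?F = "nhds a \<times>\<^sub>F nhds b"
  let ?r = "\<lambda>x. padic_norm (fst x - a) * padic_norm (snd x - b)
      + (padic_norm a * padic_norm (snd x - b) + padic_norm (fst x - a) * padic_norm b)"
  have "((\<lambda>x. padic_norm (fst x * snd x - a * b)) \<longlongrightarrow> 0) ?F"
  proof (rule tendsto_sandwich[OF _ _ tendsto_const])
    have "((\<lambda>x. dist (fst x) a * dist (snd x) b + (padic_norm a * dist (snd x) b + dist (fst x) a * padic_norm b))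
      \<longlongrightarrow> dist a a * dist b b + (padic_norm a * dist b b + dist a a * padic_norm b)) ?F"
      by (intro tendsto_intros filterlim_fst filterlim_snd)
    then show "(?r \<longlongrightarrow> 0) ?F"
      by (simp add: dist_padic_def)
    show "\<forall>\<^sub>F x in ?F. padic_norm (fst x * snd x - a * b) \<le> ?r x"
    proof (intro always_eventually allI)
      fix x :: "'a padic \<times> 'a padic"
      \<comment> \<open>Each summand now contains a factor that tends to 0.\<close>
      have eq: "fst x * snd x - a * b = (fst x - a) * (snd x - b) + (a * (snd x - b) + (fst x - a) * b)"
        by (simp add: algebra_simps)
      show "padic_norm (fst x * snd x - a * b) \<le> ?r x"
        unfolding eq padic_norm_mult[symmetric]
        by (intro order_trans[OF padic_norm_triangle] add_left_mono padic_norm_triangle)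
    qed
  qed simp
  then show "((\<lambda>x. fst x * snd x) \<longlongrightarrow> a * b) ?F"
    by (simp only: tendsto_padic_iff)
qed

lemma continuous_on_padic_norm [continuous_intros]:
  assumes "continuous_on S g" shows "continuous_on S (\<lambda>x. padic_norm (g x))"
proof -
  have "padic_norm (g x) = dist (g x) 0" for x by (simp add: dist_padic_def)
  then show ?thesis using assms by (auto intro!: continuous_intros)
qed

text \<open>By density, the balls of radius \<open>1 / (n + 1)\<close> about rationals form a
  countable basis.\<close>

instance padic :: (prime_card) second_countable_topology
proof
  define D where "D = range (of_rat :: rat \<Rightarrow> 'a padic)"
  define B where "B = (\<lambda>(q, n). ball q (1 / real (Suc n))) ` (D \<times> (UNIV :: nat set))"
  have "topological_basis B"
  proof (rule topological_basisI)
    show "open U" if "U \<in> B" for U using that by (auto simp: B_def)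
    fix S :: "'a padic set" and x assume S: "open S" "x \<in> S"
    then obtain e where e: "e > 0" "ball x e \<subseteq> S" by (meson openE)
    obtain n where n: "1 / real (Suc n) < e / 2"
      using nat_approx_posE[of "e/2"] e by auto
    obtain r :: rat where r: "dist x (of_rat r) < 1 / real (Suc n)"
      using padic_norm_of_rat_approx[of "1 / real (Suc n)" x] by (auto simp: dist_padic_def)
    have "ball (of_rat r :: 'a padic) (1 / real (Suc n)) \<subseteq> ball x e"
    proof
      fix y :: "'a padic" assume "y \<in> ball (of_rat r) (1 / real (Suc n))"
      then have "dist (of_rat r) y < e / 2" using n by simp
      moreover have "dist x (of_rat r) < e / 2" using r n by simp
      ultimately show "y \<in> ball x e" using dist_triangle_half_r[of "of_rat r" x e y]
        by (simp add: dist_commute)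
    qed
    then show "\<exists>U\<in>B. x \<in> U \<and> U \<subseteq> S"
      using r e by (intro bexI[of _ "ball (of_rat r :: 'a padic) (1 / real (Suc n))"])
        (auto simp: B_def D_def dist_commute)
  qed
  moreover have "countable B" by (auto simp: B_def D_def)
  ultimately show "\<exists>B :: 'a padic set set. countable B \<and> open = generate_topology B"
    using topological_basis_imp_subbasis by blast
qed

text \<open>Boxes with sides from a countable basis form a countable basis. Second countability
  identifies Borel sets of a product with the product sigma-algebra in
  \<open>measurable_kernel\<close>.\<close>

instance vec :: ("{metric_space, second_countable_topology}", finite) second_countable_topology
proof
  obtain B :: "'a set set" where B: "countable B" "topological_basis B"
    using ex_countable_basis by blast
  define C where "C = (\<lambda>U. {x :: 'a ^ 'b. \<forall>i. x $ i \<in> U i}) ` (\<Pi>\<^sub>E i\<in>UNIV. B)"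
  have "topological_basis C"
  proof (rule topological_basisI)
    show "open U" if U: "U \<in> C" for U
    proof -
      obtain A where A: "A \<in> (\<Pi>\<^sub>E i\<in>UNIV. B)" "U = {x. \<forall>i. x $ i \<in> A i}"
        using U unfolding C_def by blast
      then have "open (A i)" for i using topological_basis_open[OF B(2)] by (auto simp: PiE_iff)
      then show ?thesis unfolding A(2) by (intro open_vector_box) auto
    qed
    fix S :: "('a ^ 'b) set" and x assume S: "open S" "x \<in> S"
    then obtain A where A: "\<And>i. open (A i)" "\<And>i. x $ i \<in> A i" "\<And>y. (\<forall>i. y $ i \<in> A i) \<Longrightarrow> y \<in> S"
      unfolding open_vec_def by metis
    have "\<exists>V\<in>B. x $ i \<in> V \<and> V \<subseteq> A i" for i
      using topological_basisE[OF B(2) A(1) A(2)] by metis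
    then obtain V where V: "\<And>i. V i \<in> B" "\<And>i. x $ i \<in> V i" "\<And>i. V i \<subseteq> A i" by metis
    show "\<exists>U\<in>C. x \<in> U \<and> U \<subseteq> S"
      by (rule bexI[of _ "{y. \<forall>i. y $ i \<in> V i}"]) (use V A(3) in \<open>auto simp: C_def\<close>, blast)
  qed
  moreover have "countable C"
    unfolding C_def using B(1) by (intro countable_image countable_PiE) auto
  ultimately show "\<exists>B :: ('a ^ 'b) set set. countable B \<and> open = generate_topology B"
    using topological_basis_imp_subbasis by blast
qed

text \<open>Each \<open>X n\<close> is replaced by a rational \<open>r n\<close> at distance below
  \<open>1 / (n + 1)\<close>. Then \<open>r\<close> is itself Cauchy for the p-adic norm, so it
  represents a p-adic number, and \<open>X\<close> converges to that number.\<close>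

instance padic :: (prime_card) complete_space
proof
  fix X :: "nat \<Rightarrow> 'a padic" assume X: "Cauchy X"
  have "\<exists>r. padic_norm (X n - of_rat r) < inverse (real (Suc n))" for n
    by (rule padic_norm_of_rat_approx) simp
  then obtain r where r: "\<And>n. padic_norm (X n - of_rat (r n)) < inverse (real (Suc n))" by metis
  have r0: "(\<lambda>n. dist (X n) (of_rat (r n))) \<longlonglongrightarrow> 0"
    by (rule tendsto_sandwich[OF _ _ tendsto_const LIMSEQ_inverse_real_of_nat])
       (auto simp: dist_padic_def less_imp_le[OF r] simp del: of_nat_Suc)
  have C: "\<exists>N. \<forall>m\<ge>N. \<forall>n\<ge>N. rat_norm CARD('a) (r m - r n) < e" if e: "e > 0" for e
  proof -
    obtain M where M: "\<And>m n. m \<ge> M \<Longrightarrow> n \<ge> M \<Longrightarrow> dist (X m) (X n) < e / 3"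
      using X e unfolding Cauchy_def by (metis zero_less_divide_iff zero_less_numeral)
    obtain K where K: "\<And>n. n \<ge> K \<Longrightarrow> dist (X n) (of_rat (r n)) < e / 3"
      using order_tendstoD(2)[OF r0, of "e / 3"] e by (auto simp: eventually_sequentially)
    have "rat_norm CARD('a) (r m - r n) < e" if mn: "m \<ge> max M K" "n \<ge> max M K" for m n
    proof -
      have "dist (of_rat (r m)) (of_rat (r n) :: 'a padic)
          \<le> dist (X m) (of_rat (r m)) + dist (X m) (X n) + dist (X n) (of_rat (r n))"
        by (smt (verit) dist_triangle dist_commute)
      also have "\<dots> < e" using M[of m n] K[of m] K[of n] mn by simp
      finally show ?thesis by (simp add: dist_padic_def padic_norm_of_rat flip: of_rat_diff)
    qed
    then show ?thesis by blast
  qed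
  then have cau: "padic_cauchy CARD('a) r" unfolding padic_cauchy_def by blast
  define R where "R = (Abs_cauchy_seq r :: 'a cauchy_seq)"
  have R: "Rep_cauchy_seq R = r" using cau by (simp add: R_def Abs_cauchy_seq_inverse)
  have "(\<lambda>n. dist (of_rat (r n)) (abs_padic R)) \<longlonglongrightarrow> 0"
  proof (rule LIMSEQ_I)
    fix e :: real assume e: "e > 0"
    obtain N where N: "\<forall>m\<ge>N. \<forall>n\<ge>N. rat_norm CARD('a) (r m - r n) < e / 2" using C[of "e/2"] e by auto
    have "dist (of_rat (r n)) (abs_padic R) < e" if "n \<ge> N" for n
    proof -
      have "dist (of_rat (r n)) (abs_padic R) = norm_seq (const_seq (r n) - R)"
        by (simp add: dist_padic_def of_rat_padic minus_padic.abs_eq padic_norm.abs_eq)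
      also have "\<dots> \<le> e / 2"
        by (rule LIMSEQ_le_const2[OF norm_seq_LIMSEQ])
           (use N that in \<open>force simp: minus_cauchy_seq.rep_eq const_seq.rep_eq R intro: less_imp_le\<close>)
      finally show ?thesis using e by simp
    qed
    then show "\<exists>N. \<forall>n\<ge>N. norm (dist (of_rat (r n)) (abs_padic R) - 0) < e" by auto
  qed
  then have sum0: "(\<lambda>n. dist (X n) (of_rat (r n)) + dist (of_rat (r n)) (abs_padic R)) \<longlonglongrightarrow> 0"
    using tendsto_add[OF r0] by force
  have "(\<lambda>n. dist (X n) (abs_padic R)) \<longlonglongrightarrow> 0"
    by (rule tendsto_sandwich[OF _ _ tendsto_const sum0]) (simp_all add: dist_triangle)
  then show "convergent X" by (auto simp: convergent_def tendsto_dist_iff[of X])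
qed

text \<open>The closure of a bounded range is complete and totally bounded: multiplication by
  \<open>p ^ j\<close> moves it into the unit ball, where the integers below \<open>p ^ k\<close>
  form a finite net, and dividing back gives the net \<open>?A\<close>.\<close>

instance padic :: (prime_card) heine_borel
proof
  fix X :: "nat \<Rightarrow> 'a padic"
  assume b: "bounded (range X)"
  have cl: "compact (closure (range X))"
    unfolding compact_eq_totally_bounded
  proof (intro conjI allI impI)
    show "complete (closure (range X))" by (simp add: complete_eq_closed)
    fix e :: real assume e: "e > 0"
    obtain c where c: "\<And>x. x \<in> range X \<Longrightarrow> dist 0 x \<le> c"
      using b unfolding bounded_any_center[of _ 0] by blast
    obtain j where j: "c < real CARD('a) ^ j"
      using real_arch_pow[OF prime_card_gt_1[where 'p='a]] by blast
    \<comment> \<open>Scaling back magnifies the error \<open>p powi - k\<close> of the integer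
      approximation by \<open>p ^ j\<close>; this \<open>k\<close> keeps the product below
      \<open>e\<close>.\<close>
    obtain k where k: "(1 / real CARD('a)) ^ k < e / real CARD('a) ^ j"
      using real_arch_pow_inv[of "e / real CARD('a) ^ j" "1 / real CARD('a)"] e prime_card_gt_1[where 'p='a]
      by auto
    let ?q = "of_nat CARD('a) :: 'a padic"
    have q0: "?q \<noteq> 0" by simp
    let ?A = "(\<lambda>m. of_nat m / ?q ^ j) ` {..<CARD('a) ^ k}"
    have "closure (range X) \<subseteq> {x. padic_norm x \<le> real CARD('a) ^ j}"
    proof (rule closure_minimal)
      show "range X \<subseteq> {x. padic_norm x \<le> real CARD('a) ^ j}"
        using c j by (fastforce simp: dist_padic_def)
      show "closed {x :: 'a padic. padic_norm x \<le> real CARD('a) ^ j}"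
        by (intro closed_Collect_le continuous_intros)
    qed
    also have "\<dots> \<subseteq> (\<Union>x\<in>?A. ball x e)"
    proof
      fix x :: "'a padic" assume "x \<in> {x. padic_norm x \<le> real CARD('a) ^ j}"
      then have "padic_norm (?q ^ j * x) \<le> 1"
        using prime_card_gt_1[where 'p='a]
        by (simp add: padic_norm_mult padic_norm_power padic_norm_card field_simps)
      from padic_integer_approx[OF this, of k] obtain m where m: "m < CARD('a) ^ k"
        "padic_norm (?q ^ j * x - of_nat m) \<le> real CARD('a) powi - int k" by blast
      have "padic_norm (of_nat m / ?q ^ j - x) = padic_norm (inverse (?q ^ j) * (?q ^ j * x - of_nat m))"
        using q0 by (subst padic_norm_diff_commute) (simp add: field_simps)
      also have "\<dots> \<le> real CARD('a) ^ j * real CARD('a) powi - int k"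
        unfolding padic_norm_mult padic_norm_inverse padic_norm_power padic_norm_card
        using m(2) by (intro mult_mono) (simp_all add: power_inverse)
      also have "\<dots> < e" using k prime_card_gt_1[where 'p='a]
        by (simp add: power_int_minus field_simps power_one_over)
      finally show "x \<in> (\<Union>x\<in>?A. ball x e)" using m(1) by (auto simp: dist_padic_def)
    qed
    finally show "\<exists>k. finite k \<and> closure (range X) \<subseteq> (\<Union>x\<in>k. ball x e)"
      by (intro exI[of _ ?A]) auto
  qed
  have "\<forall>n. X n \<in> closure (range X)" using closure_subset[of "range X"] by auto
  with cl show "\<exists>l r. strict_mono r \<and> (X \<circ> r) \<longlonglongrightarrow> l"
    unfolding compact_eq_seq_compact_metric seq_compact_def by metis
qed

section \<open>The standard character and balls\<close>

text \<open>Membership in \<open>Z[1/p]\<close>. Unlike in \<open>padic_frac\<close>, numerators of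
  either sign are allowed, so that differences stay in the set.\<close>

definition p_fraction :: "nat \<Rightarrow> rat \<Rightarrow> bool" where
  "p_fraction p r \<longleftrightarrow> (\<exists>a k. r = of_int a / of_nat p ^ k)"

lemma p_fraction_diff:
  assumes "p > 0" "p_fraction p r" "p_fraction p s" shows "p_fraction p (r - s)"
proof -
  obtain a k b l where r: "r = of_int a / of_nat p ^ k" and s: "s = of_int b / of_nat p ^ l"
    using assms by (auto simp: p_fraction_def)
  have "r - s = of_int (a * int p ^ l - b * int p ^ k) / of_nat p ^ (k + l)"
    unfolding r s using assms(1) by (simp add: field_simps power_add)
  then show ?thesis unfolding p_fraction_def by blast
qed

lemma p_fraction_of_nat_divide: "p_fraction p (of_nat m / of_nat p ^ k)"
  unfolding p_fraction_def by (metis of_int_of_nat_eq)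

text \<open>If \<open>a / p ^ k\<close> has norm at most 1, then \<open>p ^ k\<close> divides
  \<open>a\<close>. Both the uniqueness of the fractional part and the additivity of the character
  rest on this.\<close>

lemma p_fraction_integral_imp_Ints:
  assumes r: "p_fraction CARD('p) r" and le: "padic_norm (of_rat r :: 'p::prime_card padic) \<le> 1"
  shows "r \<in> \<int>"
proof -
  obtain a k where a: "r = of_int a / of_nat CARD('p) ^ k" using r by (auto simp: p_fraction_def)
  have "padic_norm (of_rat r :: 'p padic)
      = padic_norm (of_int a :: 'p padic) * real CARD('p) ^ k"
    by (simp add: a of_rat_mult of_rat_inverse of_rat_power divide_inverse padic_norm_mult padic_norm_inverse
        padic_norm_power padic_norm_card power_inverse)
  then have "padic_norm (of_int a :: 'p padic) \<le> real CARD('p) powi - int k"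
    using le by (simp add: power_int_minus field_simps)
  then have "int CARD('p) ^ k dvd a" by (simp only: padic_norm_of_int_le_iff)
  then obtain b where "a = int CARD('p) ^ k * b" by (auto elim: dvdE)
  then show ?thesis by (simp add: a)
qed

text \<open>Existence: multiply \<open>y\<close> by \<open>p ^ k\<close> to make it integral, take
  its residue modulo \<open>p ^ k\<close>, and divide back. Uniqueness: two candidates differ by an
  integer of absolute value below 1.\<close>

lemma padic_frac_ex1:
  fixes y :: "'p::prime_card padic"
  shows "\<exists>!r. 0 \<le> r \<and> r < 1 \<and> (\<exists>m k. r = of_nat m / of_nat CARD('p) ^ k)
     \<and> padic_norm (y - of_rat r) \<le> 1"
proof (rule ex_ex1I)
  obtain k where k: "padic_norm y \<le> real CARD('p) ^ k" by (rule padic_norm_bounded)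
  let ?q = "of_nat CARD('p) :: 'p padic"
  have "padic_norm (?q ^ k * y) \<le> 1"
    using k by (simp add: padic_norm_mult padic_norm_power padic_norm_card field_simps)
  from padic_integer_approx[OF this, of k] obtain m where m: "m < CARD('p) ^ k"
    "padic_norm (?q ^ k * y - of_nat m) \<le> real CARD('p) powi - int k" by blast
  have q0: "?q ^ k \<noteq> 0" by simp
  have "y - of_nat m / ?q ^ k = inverse (?q ^ k) * (?q ^ k * y - of_nat m)"
    using q0 by (simp add: field_simps)
  then have "padic_norm (y - of_nat m / ?q ^ k) = real CARD('p) ^ k * padic_norm (?q ^ k * y - of_nat m)"
    by (simp add: padic_norm_mult padic_norm_inverse padic_norm_power padic_norm_card power_inverse)
  also have "\<dots> \<le> 1" using m(2) by (simp add: power_int_minus field_simps)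
  finally have "padic_norm (y - of_rat (of_nat m / of_nat CARD('p) ^ k)) \<le> 1"
    by (simp add: of_rat_divide of_rat_power)
  moreover have "of_nat m / of_nat CARD('p) ^ k < (1 :: rat)"
    using m(1) by (simp flip: of_nat_power)
  ultimately show "\<exists>r. 0 \<le> r \<and> r < 1 \<and> (\<exists>m k. r = of_nat m / of_nat CARD('p) ^ k)
     \<and> padic_norm (y - of_rat r) \<le> 1"
    by (intro exI[of _ "of_nat m / of_nat CARD('p) ^ k"]) auto
next
  fix r s :: rat
  assume r: "0 \<le> r \<and> r < 1 \<and> (\<exists>m k. r = of_nat m / of_nat CARD('p) ^ k)
     \<and> padic_norm (y - of_rat r) \<le> 1"
  assume s: "0 \<le> s \<and> s < 1 \<and> (\<exists>m k. s = of_nat m / of_nat CARD('p) ^ k)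
     \<and> padic_norm (y - of_rat s) \<le> 1"
  have "p_fraction CARD('p) (r - s)"
    using r s by (intro p_fraction_diff) (auto simp: p_fraction_of_nat_divide)
  moreover have "padic_norm (of_rat (r - s) :: 'p padic) \<le> 1"
    using padic_norm_diff_le[of "y - of_rat s" 1 "y - of_rat r"] r s by (simp add: of_rat_diff)
  ultimately have "r - s \<in> \<int>" by (rule p_fraction_integral_imp_Ints)
  then obtain n where n: "r - s = of_int n" by (auto elim: Ints_cases)
  have "\<bar>r - s\<bar> < 1" using r s by linarith
  then have "n = 0" unfolding n by linarith
  then show "r = s" using n by simp
qed

lemma padic_frac_props:
  fixes y :: "'p::prime_card padic"
  shows padic_frac_nonneg: "0 \<le> padic_frac y" and padic_frac_less_1: "padic_frac y < 1"
    and p_fraction_padic_frac: "p_fraction CARD('p) (padic_frac y)"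
    and padic_norm_diff_frac: "padic_norm (y - of_rat (padic_frac y)) \<le> 1"
proof -
  have *: "0 \<le> padic_frac y \<and> padic_frac y < 1
      \<and> (\<exists>m k. padic_frac y = of_nat m / of_nat CARD('p) ^ k)
      \<and> padic_norm (y - of_rat (padic_frac y)) \<le> 1"
    unfolding padic_frac_def by (rule theI'[OF padic_frac_ex1])
  show "0 \<le> padic_frac y" "padic_frac y < 1" "padic_norm (y - of_rat (padic_frac y)) \<le> 1"
    using * by auto
  show "p_fraction CARD('p) (padic_frac y)" using * p_fraction_of_nat_divide by metis
qed

lemma padic_frac_eq_0_iff: "padic_frac y = 0 \<longleftrightarrow> padic_norm y \<le> 1"
proof
  assume "padic_norm y \<le> 1"
  then show "padic_frac y = 0"
    unfolding padic_frac_def by (intro the1_equality padic_frac_ex1) (auto intro!: exI[of _ 0])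
qed (use padic_norm_diff_frac[of y] in simp)

text \<open>Fractional parts are additive up to an integer, and \<open>exp\<close> sends
  \<open>2 * pi * \<i>\<close> times an integer to 1.\<close>

lemma padic_char_add: "padic_char (x + y) = padic_char x * padic_char y"
  for x y :: "'p::prime_card padic"
proof -
  let ?r = "padic_frac (x + y) - padic_frac x - padic_frac y"
  have "p_fraction CARD('p) ?r"
    by (intro p_fraction_diff p_fraction_padic_frac) auto
  moreover have "padic_norm (of_rat ?r :: 'p padic) \<le> 1"
    using padic_norm_diff_le[OF padic_norm_add_le[OF padic_norm_diff_frac[of x] padic_norm_diff_frac[of y]]
        padic_norm_diff_frac[of "x + y"]]
    by (simp add: of_rat_diff of_rat_add algebra_simps)
  ultimately have "?r \<in> \<int>" by (rule p_fraction_integral_imp_Ints)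
  then obtain n where "?r = of_int n" by (auto elim: Ints_cases)
  then have eq: "padic_frac (x + y) = padic_frac x + padic_frac y + of_int n" by simp
  have "exp (2 * of_real pi * \<i> * of_int n) = 1"
    using exp_integer_2pi[of "of_int n"] by (simp add: mult_ac)
  then show ?thesis
    unfolding padic_char_def eq by (simp add: of_rat_add distrib_left exp_add)
qed

text \<open>The value 1 forces the fractional part to be an integer in \<open>[0,1)\<close>, that
  is, 0. The kernel of the character is therefore the ring of p-adic integers.\<close>

lemma padic_char_eq_1_iff: "padic_char y = 1 \<longleftrightarrow> padic_norm y \<le> 1"
proof -
  have "padic_frac y = 0" if y: "padic_char y = 1"
  proof -
    have "(of_rat (padic_frac y) :: complex) = of_real (of_rat (padic_frac y))"
      by (cases "padic_frac y") (simp add: of_rat_rat)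
    then obtain n :: int where "2 * pi * of_rat (padic_frac y) = of_int (2 * n) * pi"
      using y by (auto simp: padic_char_def exp_eq_1)
    then have "(of_rat (padic_frac y) :: real) = of_rat (of_int n)" by simp
    then have "padic_frac y = of_int n" by (simp only: of_rat_eq_iff)
    then show ?thesis using padic_frac_nonneg[of y] padic_frac_less_1[of y] by simp
  qed
  then show ?thesis by (auto simp: padic_frac_eq_0_iff) (simp add: padic_char_def flip: padic_frac_eq_0_iff)
qed

lemma norm_padic_char [simp]: "norm (padic_char y) = 1"
proof -
  have "(of_rat (padic_frac y) :: complex) = of_real (of_rat (padic_frac y))"
    by (cases "padic_frac y") (simp add: of_rat_rat)
  then show ?thesis by (simp add: padic_char_def)
qed

lemma continuous_on_padic_char: "continuous_on UNIV (padic_char :: 'p::prime_card padic \<Rightarrow> complex)"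
  unfolding continuous_on_iff
proof (intro ballI allI impI)
  fix x :: "'p padic" and e :: real assume "e > 0"
  \<comment> \<open>The character is locally constant: it is trivial on differences of norm at most
    1, so the radius 1 serves every \<open>e\<close>.\<close>
  have "dist (padic_char y) (padic_char x) = 0" if "dist y x < 1" for y
    using padic_char_add[of x "y - x"] that padic_char_eq_1_iff[of "y - x"] by (simp add: dist_padic_def)
  then show "\<exists>d>0. \<forall>y\<in>UNIV. dist y x < d \<longrightarrow> dist (padic_char y) (padic_char x) < e"
    using \<open>e > 0\<close> by (metis zero_less_one)
qed

section \<open>Balls as compact open subgroups\<close>

definition pball :: "int \<Rightarrow> ('p::prime_card padic ^ 'n) set" where
  "pball k = {x. \<forall>i. padic_norm (x $ i) \<le> real CARD('p) powi k}"

lemma unit_ball_eq_pball: "unit_ball = pball 0"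
  by (simp add: unit_ball_def pball_def)

lemma zero_in_pball [simp]: "0 \<in> pball k"
  by (simp add: pball_def)

lemma pball_add: "x \<in> pball k \<Longrightarrow> y \<in> pball k \<Longrightarrow> x + y \<in> pball k"
  by (simp add: pball_def padic_norm_add_le)

lemma pball_diff: "x \<in> pball k \<Longrightarrow> y \<in> pball k \<Longrightarrow> x - y \<in> pball k"
  by (simp add: pball_def padic_norm_diff_le)

lemma pball_add_iff: "a \<in> pball k \<Longrightarrow> a + x \<in> pball k \<longleftrightarrow> x \<in> pball k"
  using pball_add pball_diff[of "a + x" k a] by fastforce

lemma pball_mono: "k \<le> l \<Longrightarrow> pball k \<subseteq> (pball l :: ('p::prime_card padic ^ 'n) set)"
  using power_int_increasing[of k l "real CARD('p)"] prime_card_gt_1[where 'p='p]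
  by (auto simp: pball_def intro: order_trans[of _ "real CARD('p) powi k"])

text \<open>Multiplication by \<open>p powi j\<close> divides the norm by \<open>p powi j\<close>,
  hence the plus sign in \<open>k + j\<close>.\<close>

lemma pball_scale: "of_nat CARD('p) powi j *s x \<in> pball k \<longleftrightarrow> x \<in> pball (k + j)"
  for x :: "'p::prime_card padic ^ 'n"
proof -
  have "real CARD('p) powi - j * c \<le> real CARD('p) powi k \<longleftrightarrow> c \<le> real CARD('p) powi (k + j)" for c
    by (simp add: power_int_minus power_int_add field_simps)
  then show ?thesis by (simp add: pball_def padic_norm_mult padic_norm_card_powi)
qed

lemma UN_pball: "(\<Union>k. pball (int k)) = (UNIV :: ('p::prime_card padic ^ 'n::finite) set)"
proof -
  have "\<exists>k. x \<in> pball (int k)" for x :: "'p padic ^ 'n"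
  proof -
    obtain c where c: "\<And>i. padic_norm (x $ i) \<le> c"
      using finite_imageI[of UNIV "\<lambda>i. padic_norm (x $ i)"] by (metis Max_ge finite rangeI)
    obtain k where "c < real CARD('p) ^ k" using real_arch_pow[OF prime_card_gt_1] by blast
    then show ?thesis using c by (auto simp: pball_def intro!: exI[of _ k] order_trans[OF c])
  qed
  then show ?thesis by auto
qed

lemma closed_pball: "closed (pball k :: ('p::prime_card padic ^ 'n::finite) set)"
  unfolding pball_def
  by (intro closed_Collect_all closed_Collect_le continuous_intros)

text \<open>By the ultrametric inequality, in each coordinate the ball of the same radius about any
  of its points stays inside.\<close>

lemma open_pball: "open (pball k :: ('p::prime_card padic ^ 'n::finite) set)"
proof -
  have "open {x :: 'p padic. padic_norm x \<le> real CARD('p) powi k}"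
    unfolding open_dist
  proof (intro ballI exI conjI allI impI)
    show "0 < real CARD('p) powi k" by simp
    fix x y :: "'p padic" assume "x \<in> {x. padic_norm x \<le> real CARD('p) powi k}"
      "dist y x < real CARD('p) powi k"
    then show "y \<in> {x. padic_norm x \<le> real CARD('p) powi k}"
      using padic_norm_add_le[of "y - x" "real CARD('p) powi k" x] by (simp add: dist_padic_def)
  qed
  then have "open {x :: 'p padic ^ 'n. \<forall>i. x $ i \<in> {x. padic_norm x \<le> real CARD('p) powi k}}"
    by (intro open_vector_box) auto
  then show ?thesis by (simp add: pball_def)
qed

lemma compact_pball: "compact (pball k :: ('p::prime_card padic ^ 'n::finite) set)"
proof -
  have "bounded (pball k :: ('p padic ^ 'n) set)"
    unfolding bounded_def
  proof (intro exI ballI)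
    fix x :: "'p padic ^ 'n" assume x: "x \<in> pball k"
    \<comment> \<open>The metric on vectors is the Euclidean combination of coordinate distances,
      not their maximum, so it is bounded by their sum.\<close>
    have "dist 0 x \<le> (\<Sum>i\<in>UNIV. dist ((0 :: 'p padic ^ 'n) $ i) (x $ i))"
      unfolding dist_vec_def by (rule L2_set_le_sum) simp
    also have "\<dots> \<le> (\<Sum>i::'n\<in>UNIV. real CARD('p) powi k)"
      using x by (intro sum_mono) (simp add: pball_def dist_padic_def)
    finally show "dist 0 x \<le> (\<Sum>i::'n\<in>UNIV. real CARD('p) powi k)" .
  qed
  then show ?thesis using closed_pball by (simp add: compact_eq_bounded_closed)
qed

section \<open>Representatives of the cosets of \<open>pball (- 1)\<close> in
  \<open>pball 0\<close>\<close>

definition digit_vecs :: "('p::prime_card padic ^ 'n) set" where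
  "digit_vecs = {x. \<forall>i. x $ i \<in> of_nat ` {..<CARD('p)}}"

lemma finite_digit_vecs: "finite (digit_vecs :: ('p::prime_card padic ^ 'n::finite) set)"
proof -
  have "digit_vecs \<subseteq> vec_lambda ` (\<Pi>\<^sub>E i\<in>(UNIV::'n set). of_nat ` {..<CARD('p)} :: 'p padic set)"
  proof
    fix x :: "'p padic ^ 'n" assume "x \<in> digit_vecs"
    then show "x \<in> vec_lambda ` (\<Pi>\<^sub>E i\<in>(UNIV::'n set). of_nat ` {..<CARD('p)} :: 'p padic set)"
      by (intro image_eqI[of _ _ "vec_nth x"]) (auto simp: digit_vecs_def)
  qed
  then show ?thesis by (rule finite_subset) (intro finite_imageI finite_PiE, auto)
qed

lemma digit_vecs_cover:
  fixes x :: "'p::prime_card padic ^ 'n::finite"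
  assumes "x \<in> pball 0"
  shows "\<exists>a\<in>digit_vecs. x - a \<in> pball (- 1)"
proof -
  have "\<exists>m<CARD('p). padic_norm (x $ i - of_nat m) \<le> real CARD('p) powi - 1" for i
    using padic_integer_approx[of "x $ i" 1] assms by (simp add: pball_def)
  then obtain m where m: "\<And>i. m i < CARD('p)"
    "\<And>i. padic_norm (x $ i - of_nat (m i)) \<le> real CARD('p) powi - 1" by metis
  then show ?thesis
    by (intro bexI[of _ "\<chi> i. of_nat (m i)"]) (auto simp: pball_def digit_vecs_def)
qed

lemma digit_vecs_subset: "digit_vecs \<subseteq> (pball 0 :: ('p::prime_card padic ^ 'n::finite) set)"
proof -
  have "padic_norm (of_nat m :: 'p padic) \<le> 1" for m
    using padic_norm_of_int_le_iff[of "int m" 0, where 'p='p] by simp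
  then show ?thesis by (auto simp: digit_vecs_def pball_def)
       (metis (no_types) imageE)
qed

text \<open>Coordinatewise, two integers in \<open>[0,p)\<close> that are congruent modulo
  \<open>p\<close> coincide.\<close>

lemma digit_vecs_unique:
  fixes a b :: "'p::prime_card padic ^ 'n::finite"
  assumes ab: "a \<in> digit_vecs" "b \<in> digit_vecs" "a - b \<in> pball (- 1)"
  shows "a = b"
proof (rule vec_eq_iff[THEN iffD2], rule allI)
  fix i
  obtain m n where m: "m < CARD('p)" "a $ i = of_nat m" and n: "n < CARD('p)" "b $ i = of_nat n"
    using ab by (fastforce simp: digit_vecs_def)
  have "padic_norm (of_int (int m - int n) :: 'p padic) \<le> real CARD('p) powi - int 1"
    using spec[OF ab(3)[unfolded pball_def mem_Collect_eq], of i] m n by simp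
  then have "int CARD('p) ^ 1 dvd int m - int n" by (simp only: padic_norm_of_int_le_iff)
  then have "int CARD('p) dvd int m - int n" by simp
  then have "int m mod int CARD('p) = int n mod int CARD('p)" by (simp add: mod_eq_dvd_iff)
  then show "a $ i = b $ i" using m n by simp
qed

text \<open>Multiplication by \<open>q\<close> carries \<open>pball 0\<close> onto
  \<open>pball (k + 1)\<close> and \<open>pball (- 1)\<close> onto \<open>pball k\<close>, so it
  transports the decomposition by digit vectors to every radius.\<close>

lemma pball_coset_decomposition:
  fixes k :: int
  defines "q \<equiv> of_nat CARD('p) powi (- k - 1) :: 'p::prime_card padic"
  shows "pball (k + 1) = (\<Union>a\<in>digit_vecs. (+) (q *s a) ` pball k :: ('p padic ^ 'n::finite) set)"
    and "disjoint_family_on (\<lambda>a. (+) (q *s a) ` pball k :: ('p padic ^ 'n::finite) set) digit_vecs"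
proof -
  have q0: "q \<noteq> 0" by (simp add: q_def)
  have s: "q *s x \<in> pball l \<longleftrightarrow> x \<in> pball (l - k - 1)" for x :: "'p padic ^ 'n" and l
    using pball_scale[of "- k - 1" x l] by (simp add: q_def algebra_simps)
  have inv: "q *s (inverse q *s x) = x" for x :: "'p padic ^ 'n"
    using q0 by (simp add: vec_eq_iff)
  show "pball (k + 1) = (\<Union>a\<in>digit_vecs. (+) (q *s a) ` pball k :: ('p padic ^ 'n) set)"
  proof (intro subset_antisym subsetI)
    fix x :: "'p padic ^ 'n" assume x: "x \<in> pball (k + 1)"
    have "q *s (inverse q *s x) \<in> pball (k + 1)" unfolding inv by (rule x)
    then have "inverse q *s x \<in> pball 0" unfolding s by simp
    then obtain a where a: "a \<in> digit_vecs" "inverse q *s x - a \<in> pball (- 1)"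
      using digit_vecs_cover by blast
    have "q *s (inverse q *s x - a) \<in> pball k" using a(2) unfolding s by simp
    then have "x - q *s a \<in> pball k"
      by (metis inv vector_ssub_ldistrib)
    then show "x \<in> (\<Union>a\<in>digit_vecs. (+) (q *s a) ` pball k)"
      using a(1) by (auto intro!: bexI[of _ a] image_eqI[of _ _ "x - q *s a"])
  next
    fix x :: "'p padic ^ 'n" assume "x \<in> (\<Union>a\<in>digit_vecs. (+) (q *s a) ` pball k)"
    then obtain a y where a: "a \<in> digit_vecs" "x = q *s a + y" "y \<in> pball k" by auto
    have "q *s a \<in> pball (k + 1)" using digit_vecs_subset a(1) by (auto simp: s)
    then show "x \<in> pball (k + 1)" using a pball_mono[of k "k + 1"] by (auto intro: pball_add)
  qed
  show "disjoint_family_on (\<lambda>a. (+) (q *s a) ` pball k :: ('p padic ^ 'n) set) digit_vecs"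
    unfolding disjoint_family_on_def
  proof (intro ballI impI, rule ccontr)
    fix a b :: "'p padic ^ 'n" assume ab: "a \<in> digit_vecs" "b \<in> digit_vecs" "a \<noteq> b"
    assume "(+) (q *s a) ` pball k \<inter> (+) (q *s b) ` pball k \<noteq> {}"
    then obtain x y where xy: "x \<in> pball k" "y \<in> pball k" "q *s a + x = q *s b + y" by auto
    then have "q *s (a - b) = y - x" by (simp add: vector_ssub_ldistrib algebra_simps)
    then have "q *s (a - b) \<in> pball k" using pball_diff[OF xy(2,1)] by simp
    then have "a - b \<in> pball (- 1)" unfolding s by simp
    then show False using digit_vecs_unique ab by blast
  qed
qed

section \<open>Haar measure and the Fourier transform\<close>

lemma dot_add_left: "dot (x + y) \<xi> = dot x \<xi> + dot y \<xi>"
  by (simp add: dot_def distrib_right sum.distrib)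

lemma padic_norm_dot_le:
  fixes x \<xi> :: "'p::prime_card padic ^ 'n::finite"
  assumes "x \<in> pball k" "\<xi> \<in> pball (- k)"
  shows "padic_norm (dot x \<xi>) \<le> 1"
  unfolding dot_def
proof (rule padic_norm_sum_le)
  fix i
  have "padic_norm (x $ i * \<xi> $ i) \<le> real CARD('p) powi k * real CARD('p) powi - k"
    unfolding padic_norm_mult using assms by (intro mult_mono) (auto simp: pball_def)
  then show "padic_norm (x $ i * \<xi> $ i) \<le> 1" by (simp add: power_int_minus)
qed simp

lemma continuous_on_dot:
  fixes g h :: "'b::topological_space \<Rightarrow> 'p::prime_card padic ^ 'n::finite"
  assumes "continuous_on S g" "continuous_on S h"
  shows "continuous_on S (\<lambda>x. dot (g x) (h x))"
  unfolding dot_def using assms by (intro continuous_intros)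

lemma continuous_on_padic_char_comp:
  "continuous_on S g \<Longrightarrow> continuous_on S (\<lambda>x. padic_char (g x))"
  by (rule continuous_on_compose2[OF continuous_on_padic_char]) auto

lemma borel_measurable_padic_vec_add [measurable]:
  "(+) a \<in> borel_measurable (borel :: ('p::prime_card padic ^ 'n::finite) measure)"
proof (rule borel_measurable_continuous_onI)
  have "(+) a = (\<lambda>x. \<chi> i. a $ i + x $ i)" by (auto simp: vec_eq_iff)
  then show "continuous_on UNIV ((+) a)" by (simp only:) (intro continuous_intros)
qed

lemma pball_in_borel [measurable]: "(pball k :: ('p::prime_card padic ^ 'n::finite) set) \<in> sets borel"
  using closed_pball by (rule borel_closed)

locale haar =
  fixes \<mu> :: "('p::prime_card padic ^ 'n::finite) measure"
  assumes normalized: "normalized_haar \<mu>"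
begin

lemma sets_haar [measurable_cong]: "sets \<mu> = sets borel"
  using normalized by (simp add: normalized_haar_def)

lemma space_haar [simp]: "space \<mu> = UNIV"
  using sets_eq_imp_space_eq[OF sets_haar] by simp

lemma pball_in_sets [measurable]: "pball k \<in> sets \<mu>"
  by (simp add: sets_haar)

lemma emeasure_translate: "A \<in> sets borel \<Longrightarrow> emeasure \<mu> ((+) a ` A) = emeasure \<mu> A"
  using normalized by (simp add: normalized_haar_def)

text \<open>Invariance is given on image sets; stated for the pushforward, it yields invariance of
  integrals through \<open>integral_distr\<close>.\<close>

lemma distr_translate: "distr \<mu> \<mu> ((+) a) = \<mu>"
proof (rule measure_eqI)
  fix A assume "A \<in> sets (distr \<mu> \<mu> ((+) a))"
  then have A: "A \<in> sets borel" by (simp add: sets_haar)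
  have "emeasure (distr \<mu> \<mu> ((+) a)) A = emeasure \<mu> ((+) a -` A)"
    using A by (subst emeasure_distr) (auto simp: sets_haar)
  also have "(+) a -` A = (+) (- a) ` A"
    by (auto intro!: image_eqI[of _ _ "a + _"])
  finally show "emeasure (distr \<mu> \<mu> ((+) a)) A = emeasure \<mu> A"
    by (simp only: emeasure_translate[OF A])
qed simp

lemma integral_translate:
  fixes g :: "'p padic ^ 'n \<Rightarrow> complex"
  assumes "g \<in> borel_measurable borel"
  shows "(LINT x|\<mu>. g (a + x)) = integral\<^sup>L \<mu> g"
proof -
  have "integral\<^sup>L (distr \<mu> \<mu> ((+) a)) g = (LINT x|\<mu>. g (a + x))"
    using assms by (intro integral_distr) measurable
  then show ?thesis by (simp add: distr_translate)
qed

text \<open>The larger ball is a disjoint union of translates of the smaller one, indexed by digit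
  vectors.\<close>

lemma emeasure_pball_Suc_card: "emeasure \<mu> (pball (k + 1)) = ennreal (real (card (digit_vecs :: ('p padic ^ 'n) set))) * emeasure \<mu> (pball k)"
proof -
  let ?q = "of_nat CARD('p) powi (- k - 1) :: 'p padic"
  have meas: "(+) (?q *s a) ` pball k \<in> sets \<mu>" for a :: "'p padic ^ 'n"
  proof -
    have "(+) (?q *s a) ` pball k = (+) (- (?q *s a)) -` pball k \<inter> space \<mu>"
      by (auto intro!: image_eqI[of _ _ "- (?q *s a) + _"])
    also have "\<dots> \<in> sets \<mu>" by measurable
    finally show ?thesis .
  qed
  have "emeasure \<mu> (pball (k + 1)) = (\<Sum>a\<in>(digit_vecs :: ('p padic ^ 'n) set). emeasure \<mu> ((+) (?q *s a) ` pball k))"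
    unfolding pball_coset_decomposition(1)
    by (intro sum_emeasure[symmetric] finite_digit_vecs pball_coset_decomposition(2)) (use meas in auto)
  also have "\<dots> = ennreal (real (card (digit_vecs :: ('p padic ^ 'n) set))) * emeasure \<mu> (pball k)"
    by (simp add: emeasure_translate ennreal_of_nat_eq_real_of_nat)
  finally show ?thesis .
qed

text \<open>The index of \<open>pball k\<close> in \<open>pball (k + 1)\<close>, which is
  independent of \<open>k\<close>; \<open>coset_index_eq_card\<close> identifies it with the number
  of digit vectors.\<close>

definition coset_index :: real where
  "coset_index = measure \<mu> (pball 1)"

lemma coset_index_eq_card: "coset_index = real (card (digit_vecs :: ('p padic ^ 'n) set))"
proof -
  have "emeasure \<mu> (pball 0) = 1"
    using normalized by (simp add: normalized_haar_def unit_ball_eq_pball)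
  then show ?thesis
    using emeasure_pball_Suc_card[of 0] by (simp add: coset_index_def measure_def)
qed

text \<open>The zero vector and the all-ones vector are distinct digit vectors. This makes the
  factor \<open>1 - 1 / coset_index\<close> in \<open>shell_mass_ge\<close> positive.\<close>

lemma two_le_coset_index: "2 \<le> coset_index"
proof -
  have "(0 :: 'p padic ^ 'n) \<in> digit_vecs" "(1 :: 'p padic ^ 'n) \<in> digit_vecs"
    using prime_gt_1_nat[OF prime_card[where 'a='p]]
    by (auto simp: digit_vecs_def intro: image_eqI[of _ _ 0] image_eqI[of _ _ 1])
  then have "card {0, 1 :: 'p padic ^ 'n} \<le> card (digit_vecs :: ('p padic ^ 'n) set)"
    by (intro card_mono finite_digit_vecs) auto
  moreover have "(0 :: 'p padic ^ 'n) \<noteq> 1" by (simp add: vec_eq_iff)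
  ultimately show ?thesis by (simp add: coset_index_eq_card)
qed

lemma emeasure_pball_Suc: "emeasure \<mu> (pball (k + 1)) = ennreal coset_index * emeasure \<mu> (pball k)"
  using emeasure_pball_Suc_card by (simp add: coset_index_eq_card)

lemma emeasure_pball: "emeasure \<mu> (pball k) = ennreal (coset_index powi k)"
proof -
  have K: "coset_index > 0" using two_le_coset_index by simp
  show ?thesis
  proof (induction k rule: int_induct[of _ 0])
    case base
    then show ?case using normalized by (simp add: normalized_haar_def flip: unit_ball_eq_pball)
  next
    case (step1 i)
    then show ?case using K by (simp add: emeasure_pball_Suc power_int_add ennreal_mult'' mult.commute)
  next
    case (step2 i)
    \<comment> \<open>Going down in radius, the positive finite factor \<open>coset_index\<close> is
      cancelled from both sides.\<close>
    have "ennreal coset_index * emeasure \<mu> (pball (i - 1)) = ennreal coset_index * ennreal (coset_index powi (i - 1))"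
      using step2 emeasure_pball_Suc[of "i - 1"] K
      by (simp add: power_int_diff ennreal_mult''[symmetric])
    then show ?case using K by (simp add: ennreal_mult_cancel_left)
  qed
qed

lemma measure_pball: "measure \<mu> (pball k) = coset_index powi k"
  using two_le_coset_index by (intro measure_eq_emeasure_eq_ennreal emeasure_pball) simp

text \<open>The balls of finite measure exhaust the space; Fubini's theorem relies on this.\<close>

sublocale sigma_finite_measure \<mu>
proof
  show "\<exists>A. countable A \<and> A \<subseteq> sets \<mu> \<and> \<Union> A = space \<mu> \<and> (\<forall>a\<in>A. emeasure \<mu> a \<noteq> \<infinity>)"
    by (intro exI[of _ "range (\<lambda>k. pball (int k))"])
       (auto simp: emeasure_pball sets_haar UN_pball)
qed

sublocale pair: pair_sigma_finite \<mu> \<mu> ..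

lemma integrable_indicator_pball [simp]:
  "integrable \<mu> (indicator (pball k) :: _ \<Rightarrow> real)"
  by (simp add: integrable_indicator_iff sets_haar emeasure_pball)

text \<open>Orthogonality: for \<open>\<xi>\<close> in the dual ball the character is trivial on
  \<open>pball k\<close>. Otherwise translation by some \<open>a\<close> in \<open>pball k\<close>
  multiplies the integral by a number other than 1, so the integral vanishes.\<close>

lemma integral_indicator_char:
  "(LINT x|\<mu>. indicator (pball k) x * padic_char (- dot x \<xi>))
    = of_real (measure \<mu> (pball k)) * indicator (pball (- k)) \<xi>"
proof (cases "\<xi> \<in> pball (- k)")
  case True
  have "(LINT x|\<mu>. indicator (pball k) x * padic_char (- dot x \<xi>))
      = (LINT x|\<mu>. of_real (indicator (pball k) x) :: complex)"
  proof (rule Bochner_Integration.integral_cong)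
    fix x
    have "x \<in> pball k \<Longrightarrow> padic_char (- dot x \<xi>) = 1"
      using padic_norm_dot_le[OF _ True] by (simp add: padic_char_eq_1_iff)
    then show "indicator (pball k) x * padic_char (- dot x \<xi>) = of_real (indicator (pball k) x)"
      by (simp add: indicator_def)
  qed simp
  also have "\<dots> = of_real (measure \<mu> (pball k))"
    by (simp only: integral_complex_of_real) simp
  finally show ?thesis using True by simp
next
  case False
  then obtain i where i: "padic_norm (\<xi> $ i) > real CARD('p) powi - k"
    by (auto simp: pball_def not_le)
  \<comment> \<open>The only nonzero coordinate has norm \<open>p powi k\<close>, the largest that
    \<open>pball k\<close> permits, and meets the coordinate of \<open>\<xi>\<close> that is too
    large.\<close>
  define a :: "'p padic ^ 'n" where "a = axis i (of_nat CARD('p) powi - k)"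
  have a: "a \<in> pball k" by (auto simp: pball_def a_def axis_def padic_norm_card_powi)
  have dot_a: "dot a \<xi> = of_nat CARD('p) powi - k * \<xi> $ i"
    by (simp add: dot_def a_def axis_def if_distrib[of "\<lambda>z. z * _"] cong: if_cong)
  have "padic_norm (- dot a \<xi>) > 1"
    unfolding dot_a padic_norm_minus padic_norm_mult padic_norm_card_powi
    using i by (simp add: power_int_minus field_simps)
  then have ne: "padic_char (- dot a \<xi>) \<noteq> 1" by (simp add: padic_char_eq_1_iff)
  let ?g = "\<lambda>x. indicator (pball k) x * padic_char (- dot x \<xi>)"
  have [measurable]: "(\<lambda>x. padic_char (- dot x \<xi>)) \<in> borel_measurable borel"
    by (intro borel_measurable_continuous_onI continuous_on_padic_char_comp continuous_on_dot continuous_intros)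
  have shift: "?g (a + x) = padic_char (- dot a \<xi>) * ?g x" for x
  proof -
    have "- dot (a + x) \<xi> = - dot a \<xi> + - dot x \<xi>" by (simp add: dot_add_left)
    then have "padic_char (- dot (a + x) \<xi>) = padic_char (- dot a \<xi>) * padic_char (- dot x \<xi>)"
      by (simp only: padic_char_add)
    then show ?thesis by (simp add: indicator_def pball_add_iff[OF a])
  qed
  have "integral\<^sup>L \<mu> ?g = (LINT x|\<mu>. ?g (a + x))"
    by (rule integral_translate[symmetric]) measurable
  also have "\<dots> = (LINT x|\<mu>. padic_char (- dot a \<xi>) * ?g x)"
    unfolding shift ..
  also have "\<dots> = padic_char (- dot a \<xi>) * integral\<^sup>L \<mu> ?g" by simp
  finally have "(1 - padic_char (- dot a \<xi>)) * integral\<^sup>L \<mu> ?g = 0" by (simp add: algebra_simps)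
  then show ?thesis using ne False by simp
qed

section \<open>The Fourier transform and its integrals over balls\<close>

definition fourier :: "('p padic ^ 'n \<Rightarrow> real) \<Rightarrow> 'p padic ^ 'n \<Rightarrow> complex" where
  "fourier A x = (LINT \<xi>|\<mu>. padic_char (- dot x \<xi>) * of_real (A \<xi>))"

text \<open>Joint continuity gives Borel measurability on the product space, whose Borel sets are
  those of the product measure.\<close>

lemma measurable_kernel [measurable]:
  "(\<lambda>(x, \<xi>). padic_char (- dot x \<xi>)) \<in> borel_measurable (\<mu> \<Otimes>\<^sub>M \<mu>)"
proof -
  have "(\<lambda>(x, \<xi>). padic_char (- dot x \<xi>)) \<in> borel_measurable (borel :: (('p padic ^ 'n) \<times> ('p padic ^ 'n)) measure)"
    unfolding case_prod_beta
    by (intro borel_measurable_continuous_onI continuous_on_padic_char_comp continuous_on_dot continuous_intros)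
  moreover have "sets (\<mu> \<Otimes>\<^sub>M \<mu>) = sets (borel :: (('p padic ^ 'n) \<times> ('p padic ^ 'n)) measure)"
    by (subst borel_prod[symmetric]) (intro sets_pair_measure_cong sets_haar)
  ultimately show ?thesis by (subst measurable_cong_sets[OF _ refl])
qed

context
  fixes A :: "'p padic ^ 'n \<Rightarrow> real"
  assumes A: "integrable \<mu> A"
begin

lemma measurable_fourier [measurable]: "fourier A \<in> borel_measurable \<mu>"
proof -
  have [measurable]: "A \<in> borel_measurable \<mu>" using A by simp
  show ?thesis unfolding fourier_def[abs_def]
    by (rule borel_measurable_lebesgue_integral) measurable
qed

text \<open>The character has modulus 1, so the kernel has modulus
  \<open>\<bar>A \<xi>\<bar>\<close> cut off to a ball of finite measure in \<open>x\<close>. This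
  cutoff is what licenses exchanging the integrals.\<close>

lemma integrable_fourier_kernel:
  "integrable (\<mu> \<Otimes>\<^sub>M \<mu>) (\<lambda>(x, \<xi>). indicator (pball k) x * (padic_char (- dot x \<xi>) * of_real (A \<xi>)))"
proof (rule pair.Fubini_integrable)
  have [measurable]: "A \<in> borel_measurable \<mu>" using A by simp
  show "(\<lambda>(x, \<xi>). indicator (pball k) x * (padic_char (- dot x \<xi>) * of_real (A \<xi>)))
      \<in> borel_measurable (\<mu> \<Otimes>\<^sub>M \<mu>)"
    by measurable
  have norm_eq: "(LINT \<xi>|\<mu>. norm (indicator (pball k) x * (padic_char (- dot x \<xi>) * of_real (A \<xi>)) :: complex))
      = indicator (pball k) x * (LINT \<xi>|\<mu>. \<bar>A \<xi>\<bar>)" for x :: "'p padic ^ 'n"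
    by (cases "x \<in> pball k") (simp_all add: norm_mult)
  show "integrable \<mu> (\<lambda>x. LINT \<xi>|\<mu>.
      norm (case (x, \<xi>) of (x, \<xi>) \<Rightarrow> indicator (pball k) x * (padic_char (- dot x \<xi>) * of_real (A \<xi>))))"
    unfolding prod.case norm_eq by simp
  show "AE x in \<mu>. integrable \<mu> (\<lambda>\<xi>. case (x, \<xi>) of (x, \<xi>) \<Rightarrow>
      indicator (pball k) x * (padic_char (- dot x \<xi>) * of_real (A \<xi>)))"
    unfolding prod.case
  proof (intro AE_I2 integrable_mult_right)
    fix x :: "'p padic ^ 'n"
    have "(\<lambda>\<xi>. padic_char (- dot x \<xi>)) \<in> borel_measurable borel"
      by (intro borel_measurable_continuous_onI continuous_on_padic_char_comp continuous_on_dot continuous_intros)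
    then have "(\<lambda>\<xi>. padic_char (- dot x \<xi>)) \<in> borel_measurable \<mu>"
      by (subst measurable_cong_sets[OF sets_haar refl])
    then show "integrable \<mu> (\<lambda>\<xi>. padic_char (- dot x \<xi>) * of_real (A \<xi>))"
      by (intro Bochner_Integration.integrable_bound[OF A] borel_measurable_times borel_measurable_of_real)
        (simp_all add: norm_mult)
  qed
qed

lemma integrable_indicator_fourier: "integrable \<mu> (\<lambda>x. indicator (pball k) x * fourier A x)"
  using pair.integrable_fst'[OF integrable_fourier_kernel[of k]] by (simp add: fourier_def)

text \<open>Integrate over \<open>x\<close> first and apply orthogonality. Since
  \<open>pball k\<close> and \<open>pball (- k)\<close> have reciprocal volumes, the right-hand side
  is the mean of \<open>A\<close> over \<open>pball (- k)\<close>.\<close>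

lemma integral_indicator_fourier:
  "(LINT x|\<mu>. indicator (pball k) x * fourier A x)
    = of_real (measure \<mu> (pball k) * (LINT \<xi>|\<mu>. indicator (pball (- k)) \<xi> * A \<xi>))"
proof -
  have "(LINT x|\<mu>. indicator (pball k) x * fourier A x)
      = (LINT x|\<mu>. LINT \<xi>|\<mu>. indicator (pball k) x * (padic_char (- dot x \<xi>) * of_real (A \<xi>)))"
    by (simp add: fourier_def)
  also have "\<dots> = (LINT \<xi>|\<mu>. LINT x|\<mu>. indicator (pball k) x * (padic_char (- dot x \<xi>) * of_real (A \<xi>)))"
    by (rule pair.Fubini_integral[OF integrable_fourier_kernel, symmetric])
  also have "\<dots> = (LINT \<xi>|\<mu>. of_real (A \<xi>) * (LINT x|\<mu>. indicator (pball k) x * padic_char (- dot x \<xi>)))"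
    by (subst integral_mult_right_zero[symmetric]) (simp add: mult_ac)
  also have "\<dots> = (LINT \<xi>|\<mu>. of_real (measure \<mu> (pball k) * (indicator (pball (- k)) \<xi> * A \<xi>)))"
    unfolding integral_indicator_char
    by (intro Bochner_Integration.integral_cong) (auto simp: indicator_def)
  also have "\<dots> = of_real (measure \<mu> (pball k) * (LINT \<xi>|\<mu>. indicator (pball (- k)) \<xi> * A \<xi>))"
    by (simp only: integral_complex_of_real integral_mult_right_zero)
  finally show ?thesis .
qed

end

end

section \<open>The heat kernel\<close>

lemma mpoly_eval_scale:
  assumes "homogeneous d f"
  shows "mpoly_eval f (c *s x) = c ^ d * mpoly_eval f x"
proof -
  have "Poly_Mapping.lookup f m * (\<Prod>i\<in>UNIV. (c *s x) $ i ^ Poly_Mapping.lookup m i)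
      = c ^ d * (Poly_Mapping.lookup f m * (\<Prod>i\<in>UNIV. x $ i ^ Poly_Mapping.lookup m i))"
    if "m \<in> Poly_Mapping.keys f" for m
  proof -
    have "(\<Sum>i\<in>UNIV. Poly_Mapping.lookup m i) = d" using that assms by (simp add: homogeneous_def)
    then show ?thesis by (simp add: power_mult_distrib prod.distrib mult_ac flip: power_sum)
  qed
  then show ?thesis by (simp add: mpoly_eval_def sum_distrib_left)
qed

lemma continuous_on_mpoly_eval:
  "continuous_on S (mpoly_eval f :: 'p::prime_card padic ^ 'n::finite \<Rightarrow> 'p padic)"
  unfolding mpoly_eval_def[abs_def]
  by (intro continuous_on_sum continuous_on_mult' continuous_on_prod' continuous_on_power'
      continuous_on_const continuous_on_component continuous_on_id)

text \<open>Every term has norm at most 1, and the ultrametric inequality passes this to the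
  sum.\<close>

lemma padic_norm_mpoly_eval_le_1:
  assumes "integral_coeffs f" "x \<in> pball 0"
  shows "padic_norm (mpoly_eval f x) \<le> 1"
  unfolding mpoly_eval_def
proof (rule padic_norm_sum_le)
  fix m
  have "(\<Prod>i\<in>UNIV. padic_norm (x $ i) ^ Poly_Mapping.lookup m i) \<le> 1"
    using assms(2) by (intro prod_le_1) (auto simp: pball_def power_le_one)
  then show "padic_norm (Poly_Mapping.lookup f m * (\<Prod>i\<in>UNIV. x $ i ^ Poly_Mapping.lookup m i)) \<le> 1"
    using assms(1) unfolding padic_norm_mult padic_norm_prod padic_norm_power integral_coeffs_def
    by (intro mult_le_one) (auto intro: prod_nonneg)
qed simp

text \<open>By homogeneity the degree can be read off a nonconstant monomial. Positivity makes
  \<open>growth\<close> exceed 1.\<close>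

lemma elliptic_degree_pos:
  assumes "elliptic d f" shows "d > 0"
proof -
  obtain m where m: "m \<in> Poly_Mapping.keys f" "m \<noteq> 0" using assms by (auto simp: elliptic_def)
  obtain i where "Poly_Mapping.lookup m i \<noteq> 0" using m(2) by (metis lookup_zero poly_mapping_eqI)
  then have "(\<Sum>i\<in>UNIV. Poly_Mapping.lookup m i) > 0" by (auto intro!: sum_pos2[of _ i])
  then show ?thesis using assms m(1) by (simp add: elliptic_def homogeneous_def)
qed

text \<open>Decay of any prescribed polynomial order, from inverting
  \<open>(1 + y / j) ^ j \<le> exp y\<close>.\<close>

lemma exp_minus_le_power:
  fixes y :: real
  assumes "y > 0" "j > 0"
  shows "exp (- y) \<le> (real j / y) ^ j"
proof -
  have "(y / j) ^ j \<le> (1 + y / j) ^ j" using assms by (intro power_mono) auto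
  also have "\<dots> \<le> exp y" using assms by (intro exp_ge_one_plus_x_over_n_power_n) auto
  finally have "inverse (exp y) \<le> inverse ((y / j) ^ j)" using assms by (intro le_imp_inverse_le) auto
  then show ?thesis using assms by (simp add: exp_minus power_divide)
qed

text \<open>Decay of order \<open>i\<close> in \<open>b ^ k\<close>, with \<open>q < b ^ i\<close>,
  bounds the terms by a geometric series of ratio \<open>q / b ^ i\<close>.\<close>

lemma summable_power_mult_exp:
  fixes q b s :: real
  assumes q: "q > 0" and b: "b > 1" and s: "s > 0"
  shows "summable (\<lambda>k. q ^ k * exp (- s * b ^ k))"
proof -
  obtain j where j: "q < b ^ j" using real_arch_pow[OF b] by blast
  \<comment> \<open>The successor ensures the positive exponent that
    \<open>exp_minus_le_power\<close> demands.\<close>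
  define i where "i = Suc j"
  have "b ^ j \<le> b ^ i" using b by (simp add: i_def)
  then have "q < b ^ i" using j by linarith
  then have qi: "q / b ^ i < 1" using b by simp
  show ?thesis
  proof (rule summable_comparison_test')
    show "summable (\<lambda>k. (i / s) ^ i * (q / b ^ i) ^ k)"
      using qi q b by (intro summable_mult summable_geometric) simp
    fix k :: nat
    have "exp (- (s * b ^ k)) \<le> (real i / (s * b ^ k)) ^ i"
      using s b by (intro exp_minus_le_power) (auto simp: i_def)
    then have "q ^ k * exp (- (s * b ^ k)) \<le> q ^ k * (real i / (s * b ^ k)) ^ i"
      using q by (intro mult_left_mono) auto
    also have "\<dots> = (i / s) ^ i * (q / b ^ i) ^ k"
      by (simp add: power_divide power_mult_distrib mult.commute flip: power_mult)
    finally show "norm (q ^ k * exp (- s * b ^ k)) \<le> (i / s) ^ i * (q / b ^ i) ^ k"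
      using q by simp
  qed
qed

lemma ennreal_le_suminf: "h k \<le> suminf h" for h :: "nat \<Rightarrow> ennreal"
  using sum_le_suminf[OF summableI, of "{k}" h] by simp

lemma complex_indicator_sel:
  "Re (indicator A x) = indicator A x" "Im (indicator A x) = 0"
  by (simp_all add: indicator_def)

section \<open>Scaling, bounds and integrability of the symbol\<close>

locale elliptic_symbol = haar \<mu> for \<mu> :: "('p::prime_card padic ^ 'n::finite) measure" +
  fixes f :: "('n, 'p padic) mpoly" and d :: nat and \<beta> :: real
  assumes beta: "\<beta> > 0"
    and elliptic: "elliptic d f"
    and integral: "integral_coeffs f"
begin

abbreviation \<psi> :: "'p padic ^ 'n \<Rightarrow> real" where
  "\<psi> \<equiv> symbol f \<beta>"

text \<open>The factor by which \<open>\<psi>\<close> increases when its argument is divided by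
  \<open>p\<close>; see \<open>symbol_scale\<close>.\<close>

definition growth :: real where
  "growth = real CARD('p) powr (real d * \<beta>)"

lemma growth_gt_1: "growth > 1"
  using prime_card_gt_1[where 'p='p] beta elliptic_degree_pos[OF elliptic]
  by (auto simp: growth_def intro!: gr_one_powr)

lemma symbol_nonneg [simp]: "\<psi> \<xi> \<ge> 0"
  by (simp add: symbol_def)

lemma symbol_scale: "\<psi> (of_nat CARD('p) powi j *s \<xi>) = growth powi - j * \<psi> \<xi>"
proof -
  have p: "real CARD('p) > 0" by simp
  have "((real CARD('p) powi - j) ^ d) powr \<beta> = growth powi - j"
    using p by (simp add: growth_def powr_powr powr_realpow[symmetric] powr_real_of_int'[symmetric] mult_ac)
  moreover have "homogeneous d f" using elliptic by (simp add: elliptic_def)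
  ultimately show ?thesis
    by (simp add: symbol_def mpoly_eval_scale padic_norm_mult padic_norm_power padic_norm_card_powi powr_mult)
qed

text \<open>Rescale \<open>\<xi>\<close> into the unit ball, where integrality of the coefficients
  gives \<open>\<psi> \<le> 1\<close>.\<close>

lemma symbol_le: "\<xi> \<in> pball k \<Longrightarrow> \<psi> \<xi> \<le> growth powi k"
proof -
  assume "\<xi> \<in> pball k"
  then have "of_nat CARD('p) powi k *s \<xi> \<in> pball 0" by (simp add: pball_scale)
  then have "\<psi> (of_nat CARD('p) powi k *s \<xi>) \<le> 1"
    using padic_norm_mpoly_eval_le_1[OF integral] beta by (simp add: symbol_def powr_le1)
  then show ?thesis using growth_gt_1 by (simp add: symbol_scale power_int_minus field_simps)
qed

lemma measurable_symbol [measurable]: "\<psi> \<in> borel_measurable borel"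
  unfolding symbol_def[abs_def]
  by (intro powr_real_measurable borel_measurable_const borel_measurable_continuous_onI
      continuous_on_padic_norm continuous_on_mpoly_eval)

text \<open>By compactness \<open>|f|\<close> attains a minimum on
  \<open>pball 0 - pball (- 1)\<close>, positive by ellipticity; scaling carries the bound to all
  other shells.\<close>

lemma symbol_ge:
  "\<exists>c>0. \<forall>k \<xi>. \<xi> \<in> pball k \<longrightarrow> \<xi> \<notin> pball (k - 1) \<longrightarrow> c * growth powi k \<le> \<psi> \<xi>"
proof -
  let ?S = "pball 0 - pball (- 1) :: ('p padic ^ 'n) set"
  have "compact ?S" by (intro compact_diff compact_pball open_pball)
  moreover have "continuous_on ?S (\<lambda>x. padic_norm (mpoly_eval f x))"
    by (intro continuous_on_padic_norm continuous_on_mpoly_eval)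
  moreover have "?S \<noteq> {}"
  proof -
    have "(1 :: 'p padic ^ 'n) \<in> ?S" using prime_card_gt_1[where 'p='p] by (auto simp: pball_def inverse_less_1_iff not_le)
    then show ?thesis by blast
  qed
  ultimately obtain x where x: "x \<in> ?S" and le: "\<And>y. y \<in> ?S \<Longrightarrow> padic_norm (mpoly_eval f x) \<le> padic_norm (mpoly_eval f y)"
    using continuous_attains_inf by metis
  show ?thesis
  proof (intro exI[of _ "\<psi> x"] conjI allI impI)
    have "x \<noteq> 0" using x by auto
    then have "mpoly_eval f x \<noteq> 0" using elliptic by (simp add: elliptic_def)
    then show "\<psi> x > 0" by (simp add: symbol_def)
    fix k and \<xi> :: "'p padic ^ 'n" assume "\<xi> \<in> pball k" "\<xi> \<notin> pball (k - 1)"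
    then have "of_nat CARD('p) powi k *s \<xi> \<in> ?S" by (simp add: pball_scale)
    then have "\<psi> x \<le> \<psi> (of_nat CARD('p) powi k *s \<xi>)"
      using le beta by (simp add: symbol_def powr_mono2)
    then show "\<psi> x * growth powi k \<le> \<psi> \<xi>"
      using growth_gt_1 by (simp add: symbol_scale power_int_minus field_simps)
  qed
qed

text \<open>On the k-th shell outside \<open>pball 0\<close> the integrand is at most
  \<open>g k\<close>, which decays doubly exponentially, while the volume of \<open>pball k\<close>
  is only \<open>coset_index ^ k\<close>.\<close>

lemma integrable_exp_symbol:
  assumes t: "t > 0"
  shows "integrable \<mu> (\<lambda>\<xi>. exp (- t * \<psi> \<xi>))"
proof (rule integrableI_bounded)
  show "(\<lambda>\<xi>. exp (- t * \<psi> \<xi>)) \<in> borel_measurable \<mu>" by measurable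
  obtain c where c: "c > 0" "\<And>k \<xi>. \<xi> \<in> pball k \<Longrightarrow> \<xi> \<notin> pball (k - 1) \<Longrightarrow> c * growth powi k \<le> \<psi> \<xi>"
    using symbol_ge by blast
  define g where "g k = exp (- (t * c) * growth ^ k)" for k
  have "ennreal (norm (exp (- t * \<psi> \<xi>)))
      \<le> indicator (pball 0) \<xi> + suminf (\<lambda>k. ennreal (g k) * indicator (pball (int k)) \<xi>)" for \<xi>
  proof (cases "\<xi> \<in> pball 0")
    case True
    have "ennreal (norm (exp (- t * \<psi> \<xi>))) \<le> 1" using t by simp
    also have "\<dots> \<le> 1 + suminf (\<lambda>k. ennreal (g k) * indicator (pball (int k)) \<xi>)" by simp
    finally show ?thesis using True by simp
  next
    case False
    obtain K where "\<xi> \<in> pball (int K)" using UN_pball by blast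
    \<comment> \<open>Minimality puts \<open>\<xi>\<close> in \<open>pball k\<close> but not in
      \<open>pball (k - 1)\<close>, where the lower bound on \<open>\<psi>\<close> applies;
      \<open>k\<close> is positive because \<open>\<xi>\<close> lies outside
      \<open>pball 0\<close>.\<close>
    define k where "k = (LEAST k. \<xi> \<in> pball (int k))"
    have k: "\<xi> \<in> pball (int k)" unfolding k_def using \<open>\<xi> \<in> pball (int K)\<close> by (rule LeastI)
    then obtain l where l: "k = Suc l" using False by (cases k) auto
    have "\<xi> \<notin> pball (int l)" using not_less_Least[of l "\<lambda>k. \<xi> \<in> pball (int k)"] l k_def by simp
    then have "c * growth powi int k \<le> \<psi> \<xi>" using k by (intro c(2)) (simp_all add: l)
    then have "t * (c * growth ^ k) \<le> t * \<psi> \<xi>" using t by simp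
    then have "ennreal (norm (exp (- t * \<psi> \<xi>))) \<le> ennreal (g k) * indicator (pball (int k)) \<xi>"
      using k by (simp add: g_def mult.assoc)
    also have "\<dots> \<le> suminf (\<lambda>k. ennreal (g k) * indicator (pball (int k)) \<xi>)"
      by (rule ennreal_le_suminf)
    finally show ?thesis using False by simp
  qed
  then have "(\<integral>\<^sup>+ \<xi>. norm (exp (- t * \<psi> \<xi>)) \<partial>\<mu>)
      \<le> (\<integral>\<^sup>+ \<xi>. indicator (pball 0) \<xi> + suminf (\<lambda>k. ennreal (g k) * indicator (pball (int k)) \<xi>) \<partial>\<mu>)"
    by (rule nn_integral_mono)
  also have "\<dots> = 1 + suminf (\<lambda>k. ennreal (g k) * ennreal (coset_index ^ k))"
    by (simp add: nn_integral_add nn_integral_suminf nn_integral_cmult_indicator emeasure_pball)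
  also have "(\<lambda>k. ennreal (g k) * ennreal (coset_index ^ k)) = (\<lambda>k. ennreal (coset_index ^ k * exp (- (t * c) * growth ^ k)))"
    by (simp add: g_def ennreal_mult''[symmetric] mult.commute)
  also have "suminf (\<lambda>k. ennreal (coset_index ^ k * exp (- (t * c) * growth ^ k))) = ennreal (suminf (\<lambda>k. coset_index ^ k * exp (- (t * c) * growth ^ k)))"
    using two_le_coset_index growth_gt_1 t c(1) by (intro suminf_ennreal2 summable_power_mult_exp) auto
  finally show "(\<integral>\<^sup>+ \<xi>. norm (exp (- t * \<psi> \<xi>)) \<partial>\<mu>) < \<infinity>"
    by (rule order_le_less_trans) simp
qed

lemma heat_kernel_eq_fourier: "heat_kernel \<mu> f \<beta> t = fourier (\<lambda>\<xi>. exp (- t * \<psi> \<xi>))"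
  by (simp add: fun_eq_iff heat_kernel_def fourier_def)

lemma measurable_heat_kernel [measurable]: "t > 0 \<Longrightarrow> heat_kernel \<mu> f \<beta> t \<in> borel_measurable \<mu>"
  unfolding heat_kernel_eq_fourier by (intro measurable_fourier integrable_exp_symbol)

section \<open>Mass of the heat kernel on compact shells\<close>

definition shell :: "nat \<Rightarrow> 'p padic ^ 'n \<Rightarrow> real" where
  "shell N = indicator (pball (int N) - pball 0)"

lemma shell_eq: "shell N x = indicator (pball (int N)) x - indicator (pball 0) x"
  using pball_mono[of 0 "int N"] by (auto simp: shell_def indicator_def)

lemma integrable_shell_heat_kernel:
  "t > 0 \<Longrightarrow> integrable \<mu> (\<lambda>x. shell N x * Re (heat_kernel \<mu> f \<beta> t x))"
proof -
  assume "t > 0"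
  then have "integrable \<mu> (\<lambda>x. indicator (pball k) x * heat_kernel \<mu> f \<beta> t x)" for k
    unfolding heat_kernel_eq_fourier by (intro integrable_indicator_fourier integrable_exp_symbol)
  from Bochner_Integration.integrable_diff[OF this[of "int N"] this[of 0]]
  have "integrable \<mu> (\<lambda>x. Re (indicator (pball (int N)) x * heat_kernel \<mu> f \<beta> t x
      - indicator (pball 0) x * heat_kernel \<mu> f \<beta> t x))"
    by (rule integrable_Re)
  then show ?thesis
    by (simp add: shell_eq complex_indicator_sel left_diff_distrib)
qed

text \<open>The ball formula for \<open>fourier\<close> at radii \<open>N\<close> and 0: the result
  is the mean over \<open>pball (- N)\<close> minus the mean over \<open>pball 0\<close>.\<close>

lemma integral_shell_heat_kernel:
  assumes t: "t > 0"
  shows "(LINT x|\<mu>. shell N x * Re (heat_kernel \<mu> f \<beta> t x))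
    = coset_index ^ N * (LINT \<xi>|\<mu>. indicator (pball (- int N)) \<xi> * exp (- t * \<psi> \<xi>))
      - (LINT \<xi>|\<mu>. indicator (pball 0) \<xi> * exp (- t * \<psi> \<xi>))"
proof -
  note A = integrable_exp_symbol[OF t]
  have int: "integrable \<mu> (\<lambda>x. indicator (pball k) x * heat_kernel \<mu> f \<beta> t x)" for k
    unfolding heat_kernel_eq_fourier by (intro integrable_indicator_fourier A)
  have val: "(LINT x|\<mu>. indicator (pball k) x * heat_kernel \<mu> f \<beta> t x)
      = of_real (coset_index powi k * (LINT \<xi>|\<mu>. indicator (pball (- k)) \<xi> * exp (- t * \<psi> \<xi>)))" for k
    unfolding heat_kernel_eq_fourier integral_indicator_fourier[OF A] measure_pball ..
  have "(LINT x|\<mu>. shell N x * Re (heat_kernel \<mu> f \<beta> t x))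
      = (LINT x|\<mu>. Re (indicator (pball (int N)) x * heat_kernel \<mu> f \<beta> t x
          - indicator (pball 0) x * heat_kernel \<mu> f \<beta> t x))"
    by (simp add: shell_eq complex_indicator_sel left_diff_distrib)
  also have "\<dots> = Re ((LINT x|\<mu>. indicator (pball (int N)) x * heat_kernel \<mu> f \<beta> t x)
      - (LINT x|\<mu>. indicator (pball 0) x * heat_kernel \<mu> f \<beta> t x))"
    by (simp only: integral_Re[OF Bochner_Integration.integrable_diff[OF int int]]
        Bochner_Integration.integral_diff[OF int int])
  also have "\<dots> = coset_index ^ N * (LINT \<xi>|\<mu>. indicator (pball (- int N)) \<xi> * exp (- t * \<psi> \<xi>))
      - (LINT \<xi>|\<mu>. indicator (pball 0) \<xi> * exp (- t * \<psi> \<xi>))"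
    unfolding val by simp
  finally show ?thesis .
qed

lemma shell_mass_ge:
  obtains N \<kappa> where "\<kappa> > 0"
    "\<And>t. 0 < t \<Longrightarrow> t \<le> 1 \<Longrightarrow> t * \<kappa> \<le> (LINT x|\<mu>. shell N x * Re (heat_kernel \<mu> f \<beta> t x))"
proof -
  obtain c where c: "c > 0" "\<And>k \<xi>. \<xi> \<in> pball k \<Longrightarrow> \<xi> \<notin> pball (k - 1) \<Longrightarrow> c * growth powi k \<le> \<psi> \<xi>"
    using symbol_ge by blast
  \<comment> \<open>The first factor is the proportion of \<open>pball 0\<close> outside
    \<open>pball (- 1)\<close>; the second bounds \<open>(1 - exp (- (t * c))) / t\<close> from
    below for \<open>0 < t \<le> 1\<close>.\<close>
  define \<delta> where "\<delta> = (1 - 1 / coset_index) * (c * exp (- c))"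
  have \<delta>: "\<delta> > 0" using two_le_coset_index c(1) by (simp add: \<delta>_def)
  \<comment> \<open>\<open>N\<close> is chosen so that the deficit of the mean over the small ball
    uses up at most half of the gain \<open>t * \<delta>\<close>.\<close>
  obtain N where N: "(1 / growth) ^ N < \<delta> / 2"
    using real_arch_pow_inv[of "\<delta> / 2" "1 / growth"] \<delta> growth_gt_1 by auto
  show ?thesis
  proof
    show "\<delta> / 2 > 0" using \<delta> by simp
    fix t :: real assume t: "0 < t" "t \<le> 1"
    let ?A = "\<lambda>\<xi>. exp (- t * \<psi> \<xi>)"
    have iA: "integrable \<mu> (\<lambda>\<xi>. indicator (pball k) \<xi> * ?A \<xi>)" for k
      using integrable_mult_indicator[OF pball_in_sets integrable_exp_symbol[OF t(1)], of k] by simp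
    have "coset_index ^ N * (LINT \<xi>|\<mu>. indicator (pball (- int N)) \<xi> * ?A \<xi>)
        \<ge> coset_index ^ N * (LINT \<xi>|\<mu>. (1 - t * (1 / growth) ^ N) * indicator (pball (- int N)) \<xi>)"
    proof (intro mult_left_mono integral_mono iA)
      fix \<xi>
      show "(1 - t * (1 / growth) ^ N) * indicator (pball (- int N)) \<xi> \<le> indicator (pball (- int N)) \<xi> * ?A \<xi>"
      proof (cases "\<xi> \<in> pball (- int N)")
        case True
        have "\<psi> \<xi> \<le> (1 / growth) ^ N"
          using symbol_le[OF True] by (simp add: power_int_minus power_one_over inverse_eq_divide)
        then have "t * \<psi> \<xi> \<le> t * (1 / growth) ^ N" using t by (intro mult_left_mono) auto
        moreover have "1 + - t * \<psi> \<xi> \<le> ?A \<xi>" by (rule exp_ge_add_one_self)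
        ultimately show ?thesis using True by simp
      qed simp
    qed (use two_le_coset_index in auto)
    also have "coset_index ^ N * (LINT \<xi>|\<mu>. (1 - t * (1 / growth) ^ N) * indicator (pball (- int N)) \<xi>) = 1 - t * (1 / growth) ^ N"
      using two_le_coset_index by (simp add: measure_pball power_int_minus)
    finally have J1: "1 - t * (1 / growth) ^ N \<le> coset_index ^ N * (LINT \<xi>|\<mu>. indicator (pball (- int N)) \<xi> * ?A \<xi>)" .
    \<comment> \<open>With \<open>s = t * c \<le> c\<close>:
      \<open>(1 + s) * exp (- s) \<le> 1\<close> gives
      \<open>1 - exp (- s) \<ge> s * exp (- s) \<ge> s * exp (- c)\<close>.\<close>
    have exp_le: "exp (- (t * c)) \<le> 1 - t * (c * exp (- c))"
    proof -
      have "t * c * exp (- c) \<le> t * c * exp (- (t * c))"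
        using t c(1) by (intro mult_left_mono) (auto simp: mult_left_le_one_le)
      moreover have "(1 + t * c) * exp (- (t * c)) \<le> exp (t * c) * exp (- (t * c))"
        by (intro mult_right_mono exp_ge_add_one_self) auto
      ultimately show ?thesis by (simp add: algebra_simps flip: exp_add)
    qed
    \<comment> \<open>The majorant equals \<open>exp (- (t * c))\<close> on the unit shell and 1 on
      \<open>pball (- 1)\<close>, written through indicators of balls whose volumes are
      known.\<close>
    have "(LINT \<xi>|\<mu>. indicator (pball 0) \<xi> * ?A \<xi>)
        \<le> (LINT \<xi>|\<mu>. exp (- (t * c)) * indicator (pball 0) \<xi> + (1 - exp (- (t * c))) * indicator (pball (- 1)) \<xi>)"
    proof (intro integral_mono iA)
      fix \<xi> :: "'p padic ^ 'n"
      consider "\<xi> \<notin> pball 0" | "\<xi> \<in> pball 0" "\<xi> \<notin> pball (- 1)" | "\<xi> \<in> pball (- 1)" "\<xi> \<in> pball 0"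
        using pball_mono[of "- 1" 0] by blast
      then show "indicator (pball 0) \<xi> * ?A \<xi>
          \<le> exp (- (t * c)) * indicator (pball 0) \<xi> + (1 - exp (- (t * c))) * indicator (pball (- 1)) \<xi>"
      proof cases
        case 1
        then show ?thesis using pball_mono[of "- 1" 0] by (auto simp: indicator_def)
      next
        case 2
        then show ?thesis using c(2)[of \<xi> 0] t by simp
      next
        case 3
        then show ?thesis using t by simp
      qed
    qed auto
    also have "\<dots> = exp (- (t * c)) + (1 - exp (- (t * c))) * (1 / coset_index)"
      using two_le_coset_index by (simp add: measure_pball power_int_minus inverse_eq_divide)
    also have "\<dots> = 1 - (1 - 1 / coset_index) * (1 - exp (- (t * c)))"
      by (simp add: algebra_simps)
    also have "\<dots> \<le> 1 - (1 - 1 / coset_index) * (t * (c * exp (- c)))"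
      using exp_le two_le_coset_index by (intro diff_left_mono mult_left_mono) auto
    also have "\<dots> = 1 - t * \<delta>" by (simp add: \<delta>_def mult_ac)
    finally have J0: "(LINT \<xi>|\<mu>. indicator (pball 0) \<xi> * ?A \<xi>) \<le> 1 - t * \<delta>" .
    have "t * (1 / growth) ^ N \<le> t * (\<delta> / 2)" using N t by (intro mult_left_mono) auto
    then show "t * (\<delta> / 2) \<le> (LINT x|\<mu>. shell N x * Re (heat_kernel \<mu> f \<beta> t x))"
      unfolding integral_shell_heat_kernel[OF t(1)] using J1 J0 by (simp add: algebra_simps)
  qed
qed

end

section \<open>Failure of the three conditions\<close>

lemma quadratic_form_double: "quadratic_form q \<Longrightarrow> q (x + x) = 4 * q x"
proof -
  assume q: "quadratic_form q"
  from q have "q 0 = 0" using spec[OF spec[OF q[unfolded quadratic_form_def], of 0], of 0] by simp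
  then show "q (x + x) = 4 * q x" using spec[OF spec[OF q[unfolded quadratic_form_def], of x], of x] by simp
qed

text \<open>The parallelogram identity for \<open>(m + 1) x\<close> and \<open>x\<close> is a
  second-order recurrence in \<open>m\<close>, hence the induction with two base cases.\<close>

lemma quadratic_form_of_nat_mult:
  fixes q :: "'a::comm_ring_1 ^ 'n::finite \<Rightarrow> real"
  assumes q: "quadratic_form q"
  shows "q (of_nat m *s x) = real m ^ 2 * q x"
proof (induction m rule: induct_nat_012)
  case 0
  have "q 0 = 0" using quadratic_form_double[OF q, of 0] by simp
  then show ?case by simp
next
  case 1
  show ?case by simp
next
  case (ge2 m)
  have "2 * q (of_nat (Suc m) *s x) + 2 * q x = q (of_nat (Suc m) *s x + x) + q (of_nat (Suc m) *s x - x)"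
    using q by (simp add: quadratic_form_def)
  moreover have "of_nat (Suc m) *s x + x = of_nat (Suc (Suc m)) *s x" "of_nat (Suc m) *s x - x = of_nat m *s x"
    by (simp_all add: vec_eq_iff algebra_simps)
  ultimately show ?case using ge2 by (simp add: algebra_simps power2_eq_square)
qed

lemma continuous_on_indicator_clopen:
  assumes "open A" "closed A"
  shows "continuous_on S (indicator A :: 'a::topological_space \<Rightarrow> real)"
proof -
  have "continuous_on (A \<union> - A) (indicator A :: 'a \<Rightarrow> real)"
    using assms by (intro continuous_on_open_Un continuous_on_eq[OF continuous_on_const]) (auto simp: open_Compl)
  then show ?thesis by (rule continuous_on_subset) auto
qed

context elliptic_symbol
begin

text \<open>At the nonzero vector \<open>1\<close>, multiplication by \<open>p\<close> would scale
  the positive value \<open>\<psi> 1\<close> both by \<open>1 / growth < 1\<close> and by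
  \<open>p ^ 2 > 1\<close>.\<close>

lemma not_quadratic:
  assumes "quadratic_form q" "\<And>\<xi>. \<psi> \<xi> = q \<xi>"
  shows False
proof -
  let ?p = "real CARD('p)"
  have "mpoly_eval f 1 \<noteq> 0" using elliptic by (simp add: elliptic_def)
  then have pos: "\<psi> 1 > 0" by (simp add: symbol_def)
  have "growth powi - 1 * \<psi> 1 = ?p ^ 2 * \<psi> 1"
    using quadratic_form_of_nat_mult[OF assms(1), of "CARD('p)" 1] symbol_scale[of 1 1]
    by (auto simp: assms(2))
  then have "inverse growth = ?p ^ 2" using pos by (simp add: power_int_minus)
  moreover have "inverse growth < 1" using growth_gt_1 by (simp add: inverse_less_1_iff)
  moreover have "?p ^ 2 > 1" using prime_card_gt_1[where 'p='p] by (intro one_less_power) auto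
  ultimately show False by simp
qed

section \<open>From the heat kernel to the heat measure\<close>

lemma shell_nonneg: "0 \<le> shell N x"
  by (simp add: shell_def)

lemma measurable_shell [measurable]: "shell N \<in> borel_measurable borel"
  unfolding shell_def by measurable

text \<open>The shell is open and closed, so its indicator is continuous; it is also compact and
  avoids 0.\<close>

lemma shell_in_Cc_on: "shell N \<in> Cc_on (- {0})"
  unfolding Cc_on_def
proof (intro CollectI conjI exI ballI)
  have "open (pball (int N) - pball 0 :: ('p padic ^ 'n) set)" "closed (pball (int N) - pball 0 :: ('p padic ^ 'n) set)"
    by (intro open_Diff closed_Diff open_pball closed_pball)+
  then show "continuous_on (- {0}) (shell N)"
    unfolding shell_def by (rule continuous_on_indicator_clopen)
  show "compact (pball (int N) - pball 0 :: ('p padic ^ 'n) set)"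
    by (intro compact_diff compact_pball open_pball)
  show "pball (int N) - pball 0 \<subseteq> - {0 :: 'p padic ^ 'n}" by auto
  show "shell N x = 0" if "x \<in> - {0} - (pball (int N) - pball 0)" for x
    using that by (simp add: shell_def)
qed

lemma sets_heat_measure: "sets (heat_measure \<mu> f \<beta> t) = sets borel"
  by (simp add: heat_measure_def sets_haar)

text \<open>\<open>ennreal\<close> truncates negative densities to 0, which is where the positive
  part comes from.\<close>

lemma nn_integral_shell_heat_measure:
  assumes t: "t > 0"
  shows "(\<integral>\<^sup>+x. ennreal (shell N x) \<partial>heat_measure \<mu> f \<beta> t)
    = ennreal (LINT x|\<mu>. max 0 (shell N x * Re (heat_kernel \<mu> f \<beta> t x)))"
proof -
  note [measurable] = measurable_heat_kernel[OF t]
  have "(\<integral>\<^sup>+x. ennreal (shell N x) \<partial>heat_measure \<mu> f \<beta> t)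
      = (\<integral>\<^sup>+x. ennreal (Re (heat_kernel \<mu> f \<beta> t x)) * ennreal (shell N x) \<partial>\<mu>)"
    unfolding heat_measure_def by (rule nn_integral_density) measurable
  also have "\<dots> = (\<integral>\<^sup>+x. ennreal (max 0 (shell N x * Re (heat_kernel \<mu> f \<beta> t x))) \<partial>\<mu>)"
    \<comment> \<open>Truncation commutes with multiplication by \<open>shell N\<close>, whose only
      values are 0 and 1.\<close>
    by (intro nn_integral_cong) (simp add: shell_def indicator_def max_def ennreal_neg)
  also have "\<dots> = ennreal (LINT x|\<mu>. max 0 (shell N x * Re (heat_kernel \<mu> f \<beta> t x)))"
    using integrable_shell_heat_kernel[OF t, of N] by (intro nn_integral_eq_integral integrable_max) auto
  finally show ?thesis .
qed

text \<open>The positive part dominates the integrand, so the bound of \<open>shell_mass_ge\<close>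
  survives truncation.\<close>

lemma heat_mass_ge:
  obtains N \<kappa> where "\<kappa> > 0"
    "\<And>t. 0 < t \<Longrightarrow> t \<le> 1 \<Longrightarrow>
      t * \<kappa> \<le> (LINT x|\<mu>. max 0 (shell N x * Re (heat_kernel \<mu> f \<beta> t x)))"
proof -
  obtain N \<kappa> where \<kappa>: "\<kappa> > 0"
    "\<And>t. 0 < t \<Longrightarrow> t \<le> 1 \<Longrightarrow> t * \<kappa> \<le> (LINT x|\<mu>. shell N x * Re (heat_kernel \<mu> f \<beta> t x))"
    by (rule shell_mass_ge) blast
  have "(LINT x|\<mu>. shell N x * Re (heat_kernel \<mu> f \<beta> t x))
      \<le> (LINT x|\<mu>. max 0 (shell N x * Re (heat_kernel \<mu> f \<beta> t x)))" if "t > 0" for t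
    using integrable_shell_heat_kernel[OF that, of N] by (intro integral_mono integrable_max) auto
  then show ?thesis using \<kappa> by (intro that[of \<kappa> N]) (auto intro: order_trans)
qed

text \<open>The mass outside the neighbourhood \<open>pball 0\<close> dominates the shell integral,
  so its ratio to \<open>t\<close> stays at least \<open>\<kappa>\<close> for
  \<open>t \<le> 1\<close>.\<close>

lemma heat_measure_not_local:
  "\<not> ((\<lambda>t. emeasure (heat_measure \<mu> f \<beta> t) (UNIV - pball 0) / ennreal t) \<longlongrightarrow> 0) (at_right 0)"
proof
  assume lim: "((\<lambda>t. emeasure (heat_measure \<mu> f \<beta> t) (UNIV - pball 0) / ennreal t) \<longlongrightarrow> 0) (at_right 0)"
  obtain N \<kappa> where \<kappa>: "\<kappa> > 0" "\<And>t. 0 < t \<Longrightarrow> t \<le> 1 \<Longrightarrow>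
      t * \<kappa> \<le> (LINT x|\<mu>. max 0 (shell N x * Re (heat_kernel \<mu> f \<beta> t x)))"
    by (rule heat_mass_ge) blast
  have ge: "ennreal \<kappa> \<le> emeasure (heat_measure \<mu> f \<beta> t) (UNIV - pball 0) / ennreal t"
    if t: "0 < t" "t \<le> 1" for t
  proof -
    have "ennreal t * ennreal \<kappa> = ennreal (t * \<kappa>)" using t \<kappa>(1) by (simp add: ennreal_mult)
    also have "\<dots> \<le> (\<integral>\<^sup>+x. ennreal (shell N x) \<partial>heat_measure \<mu> f \<beta> t)"
      unfolding nn_integral_shell_heat_measure[OF t(1)] using \<kappa>(2)[OF t] by (rule ennreal_leI)
    also have "\<dots> \<le> (\<integral>\<^sup>+x. indicator (UNIV - pball 0) x \<partial>heat_measure \<mu> f \<beta> t)"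
      by (intro nn_integral_mono) (auto simp: shell_def indicator_def)
    also have "\<dots> = emeasure (heat_measure \<mu> f \<beta> t) (UNIV - pball 0)"
      by (intro nn_integral_indicator) (auto simp: sets_heat_measure)
    finally have "ennreal t * ennreal \<kappa> / ennreal t \<le> emeasure (heat_measure \<mu> f \<beta> t) (UNIV - pball 0) / ennreal t"
      by (rule divide_right_mono_ennreal)
    then show ?thesis using t by (simp add: ennreal_mult_divide_eq mult.commute[of "ennreal t"])
  qed
  have "ennreal \<kappa> \<le> 0"
  proof (rule tendsto_lowerbound[OF lim])
    show "\<forall>\<^sub>F t in at_right 0. ennreal \<kappa> \<le> emeasure (heat_measure \<mu> f \<beta> t) (UNIV - pball 0) / ennreal t"
      using eventually_at_right_real[of 0 1] by (auto elim!: eventually_mono intro: ge)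
  qed simp
  then show False using \<kappa>(1) by simp
qed

text \<open>Tested against \<open>shell N\<close>, the scaled measures keep integrals of at least
  \<open>\<kappa>\<close>, whereas vague convergence to the zero measure would send them to
  0.\<close>

lemma levy_measure_nonzero:
  assumes "levy_measure (heat_measure \<mu> f \<beta>) Z"
  shows "Z \<noteq> null_measure (restrict_space borel (- {0}))"
proof
  assume Z: "Z = null_measure (restrict_space borel (- {0}))"
  let ?M = "\<lambda>t. scale_measure (ennreal (1 / t)) (restrict_space (heat_measure \<mu> f \<beta> t) (- {0}))"
  obtain N \<kappa> where \<kappa>: "\<kappa> > 0" "\<And>t. 0 < t \<Longrightarrow> t \<le> 1 \<Longrightarrow>
      t * \<kappa> \<le> (LINT x|\<mu>. max 0 (shell N x * Re (heat_kernel \<mu> f \<beta> t x)))"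
    by (rule heat_mass_ge) blast
  have "((\<lambda>t. LINT x|?M t. shell N x) \<longlongrightarrow> (LINT x|Z. shell N x)) (at_right 0)"
    using assms shell_in_Cc_on by (auto simp: levy_measure_def vague_limit_on_def)
  moreover have "(LINT x|Z. shell N x) = 0"
    unfolding Z by (rule integral_null_measure)
  ultimately have lim: "((\<lambda>t. LINT x|?M t. shell N x) \<longlongrightarrow> 0) (at_right 0)" by simp
  have ge: "\<kappa> \<le> (LINT x|?M t. shell N x)" if t: "0 < t" "t \<le> 1" for t
  proof -
    let ?I = "LINT x|\<mu>. max 0 (shell N x * Re (heat_kernel \<mu> f \<beta> t x))"
    have meas: "shell N \<in> borel_measurable (heat_measure \<mu> f \<beta> t)"
      by (simp add: measurable_cong_sets[OF sets_heat_measure refl])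
    then have meas': "shell N \<in> borel_measurable (restrict_space (heat_measure \<mu> f \<beta> t) (- {0}))"
      by (rule measurable_restrict_space1)
    have "(\<integral>\<^sup>+x. ennreal (shell N x) \<partial>?M t)
        = ennreal (1 / t) * (\<integral>\<^sup>+x. ennreal (shell N x) \<partial>restrict_space (heat_measure \<mu> f \<beta> t) (- {0}))"
      by (intro nn_integral_scale_measure measurable_compose[OF meas'] measurable_ennreal)
    also have "(\<integral>\<^sup>+x. ennreal (shell N x) \<partial>restrict_space (heat_measure \<mu> f \<beta> t) (- {0}))
        = (\<integral>\<^sup>+x. ennreal (shell N x) * indicator (- {0}) x \<partial>heat_measure \<mu> f \<beta> t)"
      by (rule nn_integral_restrict_space) (auto simp: sets_heat_measure)
    \<comment> \<open>Removing the origin does not change the integral, as \<open>shell N\<close>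
      vanishes there.\<close>
    also have "\<dots> = (\<integral>\<^sup>+x. ennreal (shell N x) \<partial>heat_measure \<mu> f \<beta> t)"
      by (intro nn_integral_cong) (auto simp: shell_def indicator_def)
    also have "ennreal (1 / t) * \<dots> = ennreal (1 / t * ?I)"
      unfolding nn_integral_shell_heat_measure[OF t(1)] using t by (intro ennreal_mult[symmetric]) auto
    finally have nn: "(\<integral>\<^sup>+x. ennreal (shell N x) \<partial>?M t) = ennreal (1 / t * ?I)" .
    have "(LINT x|?M t. shell N x) = enn2real (\<integral>\<^sup>+x. ennreal (shell N x) \<partial>?M t)"
      using meas' by (intro integral_eq_nn_integral) (auto simp: shell_nonneg)
    also have "\<dots> = 1 / t * ?I" unfolding nn using t by simp
    finally have "(LINT x|?M t. shell N x) = 1 / t * ?I" .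
    moreover have "\<kappa> \<le> 1 / t * ?I" using \<kappa>(2)[OF t] t by (simp add: field_simps)
    ultimately show ?thesis by simp
  qed
  have "\<kappa> \<le> 0"
  proof (rule tendsto_lowerbound[OF lim])
    show "\<forall>\<^sub>F t in at_right 0. \<kappa> \<le> (LINT x|?M t. shell N x)"
      using eventually_at_right_real[of 0 1] by (auto elim!: eventually_mono intro: ge)
  qed simp
  then show False using \<kappa>(1) by simp
qed

end

theorem theorem4:
  fixes \<mu> :: "('p::prime_card padic ^ 'n::finite) measure"
    and f :: "('n, 'p padic) mpoly"
    and d :: nat and \<beta> :: real
    and Z :: "('p padic ^ 'n) measure"
  assumes haar: "normalized_haar \<mu>"
    and beta: "\<beta> > 0"
    and elliptic: "elliptic d f"
    and integral: "integral_coeffs f"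
    and levy: "levy_measure (heat_measure \<mu> f \<beta>) Z"
  defines "cond_i \<equiv> \<forall>W. open W \<and> 0 \<in> W \<longrightarrow>
      ((\<lambda>t. emeasure (heat_measure \<mu> f \<beta> t) (UNIV - W) / ennreal t) \<longlongrightarrow> 0) (at_right 0)"
    and "cond_ii \<equiv> Z = null_measure (restrict_space borel (- {0}))"
    and "cond_iii \<equiv> \<exists>c l q. c \<ge> 0
      \<and> additive_hom l \<and> continuous_on UNIV l
      \<and> quadratic_form q \<and> (\<forall>\<xi>. q \<xi> \<ge> 0) \<and> continuous_on UNIV q
      \<and> (\<forall>\<xi>. complex_of_real (symbol f \<beta> \<xi>)
            = complex_of_real c + \<i> * complex_of_real (l \<xi>) + complex_of_real (q \<xi>))"
  shows "(cond_i \<longleftrightarrow> cond_ii) \<and> (cond_ii \<longleftrightarrow> cond_iii)"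
proof -
  interpret elliptic_symbol \<mu> f d \<beta>
    by unfold_locales (fact haar beta elliptic integral)+
  have "\<not> cond_i"
  proof
    assume cond_i
    then have "((\<lambda>t. emeasure (heat_measure \<mu> f \<beta> t) (UNIV - pball 0) / ennreal t) \<longlongrightarrow> 0) (at_right 0)"
      unfolding cond_i_def using open_pball zero_in_pball by blast
    then show False using heat_measure_not_local by blast
  qed
  moreover have "\<not> cond_ii"
    unfolding cond_ii_def by (rule levy_measure_nonzero[OF levy])
  moreover have "\<not> cond_iii"
  proof
    assume cond_iii
    then obtain c l q where c: "c \<ge> 0" and q: "quadratic_form q"
      and eq: "\<And>\<xi>. complex_of_real (symbol f \<beta> \<xi>)
            = complex_of_real c + \<i> * complex_of_real (l \<xi>) + complex_of_real (q \<xi>)"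
      unfolding cond_iii_def by blast
    \<comment> \<open>Taking real parts removes \<open>l\<close>; evaluation at 0 then forces
      \<open>c = 0\<close>, leaving a pure quadratic form.\<close>
    have sum: "symbol f \<beta> \<xi> = c + q \<xi>" for \<xi> using arg_cong[OF eq[of \<xi>], of Re] by simp
    have "q 0 = 0" using quadratic_form_double[OF q, of 0] by simp
    moreover have "symbol f \<beta> 0 = 0" using elliptic by (simp add: symbol_def elliptic_def)
    ultimately have "c = 0" using sum[of 0] by simp
    then show False using not_quadratic[OF q] sum by simp
  qed
  ultimately show ?thesis by blast
qed

end
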